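(* Let $F$ be a tract (equipped with an involution) satisfying the following axiom (MSF): whenever $\alpha,\beta,\gamma\in\mathbb{N}[F^\times]$ are such that $\alpha+\gamma\in N_F$ and $\beta-\gamma\in N_F$, and either $\gamma=0$ or $\gamma\notin N_F$, and $\|\alpha+\beta\|\geq 4$, then $\alpha+\beta\in N_F$. Then $F$ is strongly perfect.
   Context: For an abelian group $G$, $\mathbb{N}[G]$ is the group semiring (finite formal sums of elements of $G$ with coefficients in $\mathbb{N}=\{0,1,2,\dots\}$); for $\alpha\in\mathbb{N}[G]$, $\|\alpha\|$ is the unique natural number $m$ such that $\alpha$ is a sum of $m$ elements of $G$ (with $\|0\|=0$). A tract is a multiplicatively written commutative monoid $F$ with an absorbing element $0$ such that $F^\times:=F\setminus\{0\}$ is a group, together with a subset $N_F\subseteq\mathbb{N}[F^\times]$ (the null set) such that: (T1) the zero element of $\mathbb{N}[F^\times]$ belongs to $N_F$, and $1\notin N_F$; (T2) there is a unique $\epsilon\in F^\times$ with $1+\epsilon\in N_F$; (T3) $N_F$ is closed under the natural action of $F^\times$ on $\mathbb{N}[F^\times]$. One writes $-1$ for $\epsilon$, $-\alpha$ for $\epsilon\alpha$ and $\alpha-\beta$ for $\alpha+\epsilon\beta$ ($\alpha,\beta\in\mathbb{N}[F^\times]$); $x-x$ is not the zero element of $\mathbb{N}[F^\times]$. $F$ is regarded as a subset of $\mathbb{N}[F^\times]$, with $0\in F$ identified with the zero of $\mathbb{N}[F^\times]$. A morphism of tracts $\varphi:F\to F'$ is a map with $\varphi(0)=0$, inducing a group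 homomorphism $F^\times\to(F')^\times$, and with (its additive extension satisfying) $\varphi(N_F)\subseteq N_{F'}$. Tracts are endowed with an involution $x\mapsto\bar x$, i.e. a morphism $F\to F$ whose square is the identity (possibly the identity itself); it is extended additively to $\mathbb{N}[F^\times]$. Let $E$ be a finite set. For $X,Y\in\mathbb{N}[F^\times]^E$ put $X\cdot Y:=\sum_{e\in E}X(e)\overline{Y(e)}\in\mathbb{N}[F^\times]$, and write $X\perp Y$ ($X$ is orthogonal to $Y$) if $X\cdot Y\in N_F$; for sets $S,T$, $S\perp T$ means $X\perp Y$ for all $X\in S$, $Y\in T$. The support of $X$ is $\underline{X}=\{e\in E: X(e)\neq 0\}$. Let $\underline{M}$ be an ordinary matroid on $E$. An $F$-signature of $\underline{M}$ is a subset $C\subseteq F^E$ such that (C0) $0\notin C$; (C1) if $X\in C$ and $\alpha\in F^\times$ then $\alpha X\in C$; (C2) taking supports gives a bijection from the projectivization $C/F^\times$ to the set of circuits of $\underline{M}$. A dual pair of $F$-signatures of $\underline M$ is a pair $(C,D)$ with $C$ an $F$-signature of $\underline{M}$, $D$ an $F$-signature of the dual matroid $\underline{M}^*$, and $C\perp D$. A (strong) $F$-matroid $M$ on $E$ is a matroid $\underline{M}$ on $E$ together with a dual pair $(C(M),C^*(M))$ of $F$-signatures of $\underline{M}$; the elements of $C(M)$ and $C^*(M)$ are the $F$-circuits and $F$-cocircuits of $M$. A generalized vector of $M$ is an $X\in\mathbb{N}[F^\times]^E$ with $X\perp Y$ for all $Y\in C^*(M)$; a generalized covector is an $X\in\mathbb{N}[F^\times]^E$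 with $X\perp Y$ for all $Y\in C(M)$. The sets of these are denoted $\mathcal{V}(M)$ and $\mathcal{V}^*(M)$. An $F$-matroid $M$ is strongly perfect if $\mathcal{V}(M)\perp\mathcal{V}^*(M)$; the tract $F$ is strongly perfect if every $F$-matroid is strongly perfect. *)

theory Defs
  imports "HOL-Library.Multiset" "HOL-Library.FuncSet"
begin

section \<open>The group semiring of the units\<close>

text \<open>
  A commutative monoid \<open>F\<close> with absorbing element is a type
  \<open>'a :: {comm_monoid_mult, mult_zero}\<close>. A finite formal sum of units is the multiset of its
  summands: \<open>{#}\<close> is the zero of the semiring, \<open>+\<close> its addition, and \<^const>\<open>size\<close> is the norm.
\<close>

definition gsr :: "'a::zero multiset set" where
  "gsr = {\<alpha>. 0 \<notin># \<alpha>}"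

definition gsr_act :: "'a::times \<Rightarrow> 'a multiset \<Rightarrow> 'a multiset" where
  "gsr_act a \<alpha> = {#a * x. x \<in># \<alpha>#}"

definition gsr_mult :: "'a::times multiset \<Rightarrow> 'a multiset \<Rightarrow> 'a multiset" where
  "gsr_mult \<alpha> \<beta> = (\<Sum>x\<in>#\<alpha>. {#x * y. y \<in># \<beta>#})"

text \<open>The inclusion of \<open>F\<close> sends the absorbing element to the empty sum.\<close>

definition gsr_of :: "'a::zero \<Rightarrow> 'a multiset" where
  "gsr_of x = (if x = 0 then {#} else {#x#})"


section \<open>Tracts\<close>

text \<open>
  The first two assumptions say that the nonzero elements form a group; their closure under
  multiplication follows.
\<close>

locale tract =
  fixes N :: "'a::{comm_monoid_mult, mult_zero} multiset set"
  assumes one_nonzero: "(1::'a) \<noteq> 0"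
    and invertible: "(x::'a) \<noteq> 0 \<Longrightarrow> \<exists>y. x * y = 1"
    and null_subset: "N \<subseteq> gsr"
    and T1: "{#} \<in> N" "{#1#} \<notin> N"
    and T2: "\<exists>!\<epsilon>. \<epsilon> \<noteq> 0 \<and> {#1, \<epsilon>#} \<in> N"
    and T3: "a \<noteq> 0 \<Longrightarrow> \<alpha> \<in> N \<Longrightarrow> gsr_act a \<alpha> \<in> N"

definition tract_eps :: "'a::{comm_monoid_mult, mult_zero} multiset set \<Rightarrow> 'a" where
  "tract_eps N = (THE \<epsilon>. \<epsilon> \<noteq> 0 \<and> {#1, \<epsilon>#} \<in> N)"

definition gsr_diff ::
  "'a::{comm_monoid_mult, mult_zero} multiset set \<Rightarrow> 'a multiset \<Rightarrow> 'a multiset \<Rightarrow> 'a multiset" where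
  "gsr_diff N \<alpha> \<beta> = \<alpha> + gsr_act (tract_eps N) \<beta>"

definition tract_morphism ::
  "'a::{comm_monoid_mult, mult_zero} multiset set \<Rightarrow> 'b::{comm_monoid_mult, mult_zero} multiset set
    \<Rightarrow> ('a \<Rightarrow> 'b) \<Rightarrow> bool" where
  "tract_morphism N N' \<phi> \<longleftrightarrow>
     \<phi> 0 = 0 \<and>
     (\<forall>x. x \<noteq> 0 \<longrightarrow> \<phi> x \<noteq> 0) \<and>
     (\<forall>x y. x \<noteq> 0 \<longrightarrow> y \<noteq> 0 \<longrightarrow> \<phi> (x * y) = \<phi> x * \<phi> y) \<and>
     (\<forall>\<alpha>\<in>N. image_mset \<phi> \<alpha> \<in> N')"

definition tract_involution ::
  "'a::{comm_monoid_mult, mult_zero} multiset set \<Rightarrow> ('a \<Rightarrow> 'a) \<Rightarrow> bool" where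
  "tract_involution N bar \<longleftrightarrow> tract_morphism N N bar \<and> (\<forall>x. bar (bar x) = x)"

definition MSF :: "'a::{comm_monoid_mult, mult_zero} multiset set \<Rightarrow> bool" where
  "MSF N \<longleftrightarrow>
     (\<forall>\<alpha>\<in>gsr. \<forall>\<beta>\<in>gsr. \<forall>\<gamma>\<in>gsr.
        \<alpha> + \<gamma> \<in> N \<longrightarrow> gsr_diff N \<beta> \<gamma> \<in> N \<longrightarrow> (\<gamma> = {#} \<or> \<gamma> \<notin> N) \<longrightarrow> size (\<alpha> + \<beta>) \<ge> 4 \<longrightarrow>
        \<alpha> + \<beta> \<in> N)"


section \<open>Orthogonality\<close>

text \<open>
  Vectors indexed by a finite set \<open>E\<close> are extensional functions, i.e. elements of
  \<open>E \<rightarrow>\<^sub>E UNIV\<close> (entries in \<open>F\<close>) or \<open>E \<rightarrow>\<^sub>E gsr\<close> (entries in the semiring).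
\<close>

definition dot ::
  "('a::times \<Rightarrow> 'a) \<Rightarrow> 'e set \<Rightarrow> ('e \<Rightarrow> 'a multiset) \<Rightarrow> ('e \<Rightarrow> 'a multiset) \<Rightarrow> 'a multiset" where
  "dot bar E X Y = (\<Sum>e\<in>E. gsr_mult (X e) (image_mset bar (Y e)))"

definition orth ::
  "'a::times multiset set \<Rightarrow> ('a \<Rightarrow> 'a) \<Rightarrow> 'e set \<Rightarrow>
    ('e \<Rightarrow> 'a multiset) \<Rightarrow> ('e \<Rightarrow> 'a multiset) \<Rightarrow> bool" where
  "orth N bar E X Y \<longleftrightarrow> dot bar E X Y \<in> N"

definition orth_sets ::
  "'a::times multiset set \<Rightarrow> ('a \<Rightarrow> 'a) \<Rightarrow> 'e set \<Rightarrow>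
    ('e \<Rightarrow> 'a multiset) set \<Rightarrow> ('e \<Rightarrow> 'a multiset) set \<Rightarrow> bool" where
  "orth_sets N bar E S T \<longleftrightarrow> (\<forall>X\<in>S. \<forall>Y\<in>T. orth N bar E X Y)"

definition vec_of :: "'e set \<Rightarrow> ('e \<Rightarrow> 'a::zero) \<Rightarrow> 'e \<Rightarrow> 'a multiset" where
  "vec_of E X = (\<lambda>e\<in>E. gsr_of (X e))"

definition supp :: "'e set \<Rightarrow> ('e \<Rightarrow> 'a::zero) \<Rightarrow> 'e set" where
  "supp E X = {e \<in> E. X e \<noteq> 0}"

definition scale :: "'e set \<Rightarrow> 'a::times \<Rightarrow> ('e \<Rightarrow> 'a) \<Rightarrow> 'e \<Rightarrow> 'a" where
  "scale E a X = (\<lambda>e\<in>E. a * X e)"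


section \<open>Matroids\<close>

text \<open>\<open>I\<close> is the family of independent sets.\<close>

locale matroid =
  fixes E :: "'e set" and I :: "'e set set"
  assumes finite_ground: "finite E"
    and indep_subset: "X \<in> I \<Longrightarrow> X \<subseteq> E"
    and indep_empty: "{} \<in> I"
    and indep_mono: "X \<in> I \<Longrightarrow> Y \<subseteq> X \<Longrightarrow> Y \<in> I"
    and augment: "X \<in> I \<Longrightarrow> Y \<in> I \<Longrightarrow> card X < card Y \<Longrightarrow> \<exists>y\<in>Y - X. insert y X \<in> I"

definition matroid_bases :: "'e set set \<Rightarrow> 'e set set" where
  "matroid_bases I = {B \<in> I. \<forall>X\<in>I. B \<subseteq> X \<longrightarrow> X = B}"

definition matroid_circuits :: "'e set \<Rightarrow> 'e set set \<Rightarrow> 'e set set" where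
  "matroid_circuits E I = {K. K \<subseteq> E \<and> K \<notin> I \<and> (\<forall>X. X \<subset> K \<longrightarrow> X \<in> I)}"

text \<open>The bases of the dual matroid are the complements of the bases.\<close>

definition dual_indep :: "'e set \<Rightarrow> 'e set set \<Rightarrow> 'e set set" where
  "dual_indep E I = {X. \<exists>B\<in>matroid_bases I. X \<subseteq> E - B}"


section \<open>Matroids over a tract\<close>

definition proj_rel ::
  "'e set \<Rightarrow> ('e \<Rightarrow> 'a::{times, zero}) set \<Rightarrow> (('e \<Rightarrow> 'a) \<times> ('e \<Rightarrow> 'a)) set" where
  "proj_rel E C = {(X, Y). X \<in> C \<and> Y \<in> C \<and> (\<exists>a. a \<noteq> 0 \<and> Y = scale E a X)}"

text \<open>
  All vectors of a class of \<^const>\<open>proj_rel\<close> have the same support, which \<^const>\<open>the_elem\<close>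
  extracts in the last condition.
\<close>

definition signature ::
  "'e set \<Rightarrow> 'e set set \<Rightarrow> ('e \<Rightarrow> 'a::{comm_monoid_mult, mult_zero}) set \<Rightarrow> bool" where
  "signature E I C \<longleftrightarrow>
     C \<subseteq> E \<rightarrow>\<^sub>E UNIV \<and>
     (\<lambda>e\<in>E. 0) \<notin> C \<and>
     (\<forall>X\<in>C. \<forall>a. a \<noteq> 0 \<longrightarrow> scale E a X \<in> C) \<and>
     bij_betw (\<lambda>K. the_elem (supp E ` K)) (C // proj_rel E C) (matroid_circuits E I)"

definition dual_pair ::
  "'a::{comm_monoid_mult, mult_zero} multiset set \<Rightarrow> ('a \<Rightarrow> 'a) \<Rightarrow> 'e set \<Rightarrow> 'e set set \<Rightarrow>
    ('e \<Rightarrow> 'a) set \<Rightarrow> ('e \<Rightarrow> 'a) set \<Rightarrow> bool" where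
  "dual_pair N bar E I C D \<longleftrightarrow>
     signature E I C \<and> signature E (dual_indep E I) D \<and>
     orth_sets N bar E (vec_of E ` C) (vec_of E ` D)"

text \<open>
  A matroid over the tract is given by its ground set \<open>E\<close>, the independent sets \<open>I\<close> of its
  underlying matroid, its circuits \<open>C\<close> and its cocircuits \<open>D\<close>.
\<close>

definition tract_matroid ::
  "'a::{comm_monoid_mult, mult_zero} multiset set \<Rightarrow> ('a \<Rightarrow> 'a) \<Rightarrow> 'e set \<Rightarrow> 'e set set \<Rightarrow>
    ('e \<Rightarrow> 'a) set \<Rightarrow> ('e \<Rightarrow> 'a) set \<Rightarrow> bool" where
  "tract_matroid N bar E I C D \<longleftrightarrow> matroid E I \<and> dual_pair N bar E I C D"

definition gen_vectors ::
  "'a::{times, zero} multiset set \<Rightarrow> ('a \<Rightarrow> 'a) \<Rightarrow> 'e set \<Rightarrow> ('e \<Rightarrow> 'a) set \<Rightarrow>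
    ('e \<Rightarrow> 'a multiset) set" where
  "gen_vectors N bar E D = {X \<in> E \<rightarrow>\<^sub>E gsr. \<forall>Y\<in>D. orth N bar E X (vec_of E Y)}"

definition gen_covectors ::
  "'a::{times, zero} multiset set \<Rightarrow> ('a \<Rightarrow> 'a) \<Rightarrow> 'e set \<Rightarrow> ('e \<Rightarrow> 'a) set \<Rightarrow>
    ('e \<Rightarrow> 'a multiset) set" where
  "gen_covectors N bar E C = {X \<in> E \<rightarrow>\<^sub>E gsr. \<forall>Y\<in>C. orth N bar E X (vec_of E Y)}"

definition strongly_perfect_matroid ::
  "'a::{times, zero} multiset set \<Rightarrow> ('a \<Rightarrow> 'a) \<Rightarrow> 'e set \<Rightarrow>
    ('e \<Rightarrow> 'a) set \<Rightarrow> ('e \<Rightarrow> 'a) set \<Rightarrow> bool" where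
  "strongly_perfect_matroid N bar E C D \<longleftrightarrow>
     orth_sets N bar E (gen_vectors N bar E D) (gen_covectors N bar E C)"

text \<open>
  HOL cannot quantify over all sets \<open>E\<close> at once, so the type \<open>'e\<close> of the ground set elements is
  a parameter; results are to be stated for every \<open>'e\<close>.
\<close>

definition strongly_perfect_tract ::
  "'a::{comm_monoid_mult, mult_zero} multiset set \<Rightarrow> ('a \<Rightarrow> 'a) \<Rightarrow> 'e itself \<Rightarrow> bool" where
  "strongly_perfect_tract N bar (_ :: 'e itself) \<longleftrightarrow>
     (\<forall>(E :: 'e set) I C D.
        tract_matroid N bar E I C D \<longrightarrow> strongly_perfect_matroid N bar E C D)"

end

theory Submission imports Defs begin

text \<open>
  Conjugating \<open>Y\<close> and the cocircuits removes the involution. Induct on the support of \<open>Y\<close>, then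
  on the number of summands of \<open>X\<close>. A summand \<open>x\<close> of \<open>X e\<close> and a cocircuit \<open>D\<close> through \<open>e\<close>
  inside the support of \<open>Y\<close> are called reducing if deleting \<open>x\<close> from \<open>X\<close> destroys \<open>X \<bottom> D\<close>. In
  that case eliminate \<open>e\<close> from \<open>Y\<close> by adding a multiple of \<open>D\<close>; fusion shows that the
  result is a covector, and a second fusion recovers \<open>X \<bottom> Y\<close> from the induction hypothesis.
  If nothing is reducing, every one-term deletion of the null sum \<open>X \<cdot> D\<close> is null. This forces \<open>1\<close> to be
  absorbed by large null sums containing \<open>1\<close>, and then absorption is a total preorder on the
  units. Deleting from \<open>X\<close> a summand away from a maximal term of \<open>X \<cdot> Y\<close> leaves a null sum by
  induction, and the deleted terms are absorbed. Sums of at most three terms escape the axiom;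
  there the matroid forces \<open>X\<close> or \<open>Y\<close> to be proportional to a circuit or a cocircuit, or
  single entries to be null.
\<close>

section \<open>Multisets of units\<close>

lemma gsr_act_empty [simp]: "gsr_act a {#} = {#}"
  by (simp add: gsr_act_def)

lemma gsr_act_add_mset [simp]: "gsr_act a (add_mset x \<alpha>) = add_mset (a * x) (gsr_act a \<alpha>)"
  by (simp add: gsr_act_def)

lemma gsr_act_union [simp]: "gsr_act a (\<alpha> + \<beta>) = gsr_act a \<alpha> + gsr_act a \<beta>"
  by (simp add: gsr_act_def)

lemma size_gsr_act [simp]: "size (gsr_act a \<alpha>) = size \<alpha>"
  by (simp add: gsr_act_def)

lemma gsr_act_act [simp]:
  fixes a b :: "'a::comm_monoid_mult"
  shows "gsr_act a (gsr_act b \<alpha>) = gsr_act (a * b) \<alpha>"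
  by (simp add: gsr_act_def multiset.map_comp o_def mult.assoc)

lemma gsr_act_one [simp]: "gsr_act (1::'a::comm_monoid_mult) \<alpha> = \<alpha>"
  by (simp add: gsr_act_def)

lemma gsr_act_sum:
  "finite A \<Longrightarrow> gsr_act a (\<Sum>e\<in>A. f e) = (\<Sum>e\<in>A. gsr_act a (f e))"
  by (induction A rule: finite_induct) auto

lemma gsr_mult_empty_left [simp]: "gsr_mult {#} \<beta> = {#}"
  by (simp add: gsr_mult_def)

lemma gsr_mult_add_mset_left [simp]:
  "gsr_mult (add_mset x \<alpha>) \<beta> = gsr_act x \<beta> + gsr_mult \<alpha> \<beta>"
  by (simp add: gsr_mult_def gsr_act_def)

lemma gsr_mult_empty_right [simp]: "gsr_mult \<alpha> {#} = {#}"
  by (induction \<alpha>) auto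

lemma gsr_mult_union_left [simp]: "gsr_mult (\<alpha> + \<beta>) \<gamma> = gsr_mult \<alpha> \<gamma> + gsr_mult \<beta> \<gamma>"
  by (simp add: gsr_mult_def)

lemma gsr_mult_union_right [simp]: "gsr_mult \<gamma> (\<alpha> + \<beta>) = gsr_mult \<gamma> \<alpha> + gsr_mult \<gamma> \<beta>"
  by (induction \<gamma>) (auto simp: ac_simps)

lemma gsr_mult_commute:
  fixes \<alpha> \<beta> :: "'a::comm_monoid_mult multiset"
  shows "gsr_mult \<alpha> \<beta> = gsr_mult \<beta> \<alpha>"
proof (induction \<alpha>)
  case (add x \<alpha>)
  have "gsr_mult \<beta> (add_mset x \<alpha>) = gsr_act x \<beta> + gsr_mult \<beta> \<alpha>"
    by (induction \<beta>) (auto simp: ac_simps)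
  with add show ?case by simp
qed simp

lemma gsr_mult_add_mset_right [simp]:
  fixes \<alpha> \<beta> :: "'a::comm_monoid_mult multiset"
  shows "gsr_mult \<alpha> (add_mset x \<beta>) = gsr_act x \<alpha> + gsr_mult \<alpha> \<beta>"
  by (metis gsr_mult_add_mset_left gsr_mult_commute)

lemma gsr_mult_act_left:
  fixes \<alpha> \<beta> :: "'a::comm_monoid_mult multiset"
  shows "gsr_mult (gsr_act a \<alpha>) \<beta> = gsr_act a (gsr_mult \<alpha> \<beta>)"
  by (induction \<alpha>) auto

lemma gsr_mult_act_right:
  fixes \<alpha> \<beta> :: "'a::comm_monoid_mult multiset"
  shows "gsr_mult \<alpha> (gsr_act a \<beta>) = gsr_act a (gsr_mult \<alpha> \<beta>)"
  by (metis gsr_mult_act_left gsr_mult_commute)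

lemma size_gsr_mult [simp]: "size (gsr_mult \<alpha> \<beta>) = size \<alpha> * size \<beta>"
  by (induction \<alpha>) auto

lemma gsr_mult_sum_left:
  "finite A \<Longrightarrow> gsr_mult (\<Sum>e\<in>A. f e) \<beta> = (\<Sum>e\<in>A. gsr_mult (f e) \<beta>)"
  by (induction A rule: finite_induct) auto

lemma gsr_mult_assoc:
  fixes \<alpha> \<beta> \<gamma> :: "'a::comm_monoid_mult multiset"
  shows "gsr_mult (gsr_mult \<alpha> \<beta>) \<gamma> = gsr_mult \<alpha> (gsr_mult \<beta> \<gamma>)"
  by (induction \<alpha>) (auto simp: gsr_mult_act_left)

lemma gsr_of_zero [simp]: "gsr_of 0 = {#}"
  by (simp add: gsr_of_def)

lemma gsr_of_nonzero: "x \<noteq> 0 \<Longrightarrow> gsr_of x = {#x#}"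
  by (simp add: gsr_of_def)


section \<open>Fusion\<close>

locale msf_tract = tract N
  for N :: "'a::{comm_monoid_mult, mult_zero} multiset set" +
  assumes msf: "MSF N"
begin

definition eps ("\<epsilon>") where "\<epsilon> = tract_eps N"

abbreviation neg :: "'a multiset \<Rightarrow> 'a multiset" where
  "neg \<alpha> \<equiv> gsr_act \<epsilon> \<alpha>"

lemma unit_inverse:
  fixes a :: 'a
  assumes "a \<noteq> 0"
  obtains b where "b \<noteq> 0" "a * b = 1" "b * a = 1"
    "\<And>x. b * (a * x) = x" "\<And>x. a * (b * x) = x"
proof -
  obtain b where b: "a * b = 1" using assms invertible by blast
  then have b': "b * a = 1" by (simp add: mult.commute)
  show thesis
  proof
    show "b \<noteq> 0" using b one_nonzero by force
    show "b * (a * x) = x" for x by (simp add: mult.assoc [symmetric] b')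
    show "a * (b * x) = x" for x by (simp add: mult.assoc [symmetric] b)
  qed fact+
qed

lemma mult_nonzero [simp]:
  fixes x y :: 'a
  shows "x * y = 0 \<longleftrightarrow> x = 0 \<or> y = 0"
  by (metis mult_zero_left mult_zero_right unit_inverse)

lemma null_nonzero: "\<alpha> \<in> N \<Longrightarrow> x \<in># \<alpha> \<Longrightarrow> x \<noteq> 0"
  using null_subset by (auto simp: gsr_def)

lemma eps_props: "\<epsilon> \<noteq> 0" "{#1, \<epsilon>#} \<in> N"
  using theI' [OF T2] by (auto simp: eps_def tract_eps_def)

lemma eps_unique: "x \<noteq> 0 \<Longrightarrow> {#1, x#} \<in> N \<Longrightarrow> x = \<epsilon>"
  using T2 eps_props by blast

lemma act_null_iff:
  assumes "a \<noteq> 0"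
  shows "gsr_act a \<alpha> \<in> N \<longleftrightarrow> \<alpha> \<in> N"
proof
  assume *: "gsr_act a \<alpha> \<in> N"
  obtain b where b: "b \<noteq> 0" "b * a = 1" using assms unit_inverse by metis
  from T3 [OF b(1) *] b show "\<alpha> \<in> N" by simp
qed (use T3 assms in blast)

lemma eps_eps [simp]: "\<epsilon> * \<epsilon> = 1"
proof -
  obtain b where b: "b \<noteq> 0" "\<epsilon> * b = 1" "b * \<epsilon> = 1" using eps_props unit_inverse by metis
  from T3 [OF b(1) eps_props(2)] b have "{#1, b#} \<in> N"
    by (simp add: add_mset_commute)
  then have "b = \<epsilon>" using b eps_unique by blast
  with b show ?thesis by simp
qed

lemma eps_eps_mult [simp]: "\<epsilon> * (\<epsilon> * x) = x"
  by (simp add: mult.assoc [symmetric])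

lemma eps_eq_zero [simp]: "\<epsilon> = 0 \<longleftrightarrow> False"
  using eps_props by simp

lemma neg_null_iff [simp]: "neg \<alpha> \<in> N \<longleftrightarrow> \<alpha> \<in> N"
  by (rule act_null_iff) simp

lemma neg_null: "\<alpha> \<in> N \<Longrightarrow> neg \<alpha> \<in> N"
  by simp

lemma empty_null [simp]: "{#} \<in> N" by (rule T1)

lemma single_not_null [simp]: "{#x#} \<notin> N"
proof (cases "x = 0")
  case True
  then show ?thesis using null_nonzero by fastforce
next
  case False
  then show ?thesis using act_null_iff [of x "{#1#}"] T1(2) by simp
qed

lemma pair_null_iff: "{#x, y#} \<in> N \<longleftrightarrow> x \<noteq> 0 \<and> y = \<epsilon> * x"
proof
  assume *: "{#x, y#} \<in> N"
  then have nz: "x \<noteq> 0" "y \<noteq> 0" using null_nonzero by fastforce+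
  then obtain b where b: "b \<noteq> 0" "b * x = 1" "\<And>z. x * (b * z) = z" using unit_inverse by metis
  from T3 [OF b(1) *] b have "{#1, b * y#} \<in> N" by simp
  then have "b * y = \<epsilon>" using eps_unique b nz by simp
  then have "x * (b * y) = \<epsilon> * x" by (simp add: mult.commute)
  then show "x \<noteq> 0 \<and> y = \<epsilon> * x" using b nz by simp
next
  assume "x \<noteq> 0 \<and> y = \<epsilon> * x"
  then show "{#x, y#} \<in> N" using T3 [OF _ eps_props(2), of x] by (simp add: mult.commute)
qed

lemma size_null: "\<alpha> \<in> N \<Longrightarrow> \<alpha> \<noteq> {#} \<Longrightarrow> size \<alpha> \<ge> 2"
  by (metis One_nat_def Suc_1 less_2_cases not_le single_not_null size_1_singleton_mset size_eq_0_iff_empty)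

text \<open>\<open>MSF\<close> as a trade: the part \<open>\<gamma>\<close> of the null sum
  \<open>A\<close> is exchanged for \<open>\<beta>\<close>. The sums enter through equations, so
  that rearrangements of multisets are left to the simplifier.\<close>

lemma fuse:
  assumes "A \<in> N" "B \<in> N" "A = \<alpha> + \<gamma>" "B = \<beta> + neg \<gamma>" "\<gamma> = {#} \<or> \<gamma> \<notin> N"
    "R = \<alpha> + \<beta>" "size R \<ge> 4"
  shows "R \<in> N"
proof -
  have g: "\<alpha> \<in> gsr" "\<gamma> \<in> gsr" "\<beta> \<in> gsr"
    using assms null_subset by (auto simp: gsr_def)
  show ?thesis
    using msf [unfolded MSF_def, rule_format, OF g(1,3,2)] assms
    by (simp add: gsr_diff_def eps_def)
qed

text \<open>Fusion along the empty sum. A nonempty null sum has at least two terms, so two of them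
  reach the size bound four.\<close>

lemma null_add:
  assumes "\<alpha> \<in> N" "\<beta> \<in> N"
  shows "\<alpha> + \<beta> \<in> N"
proof (cases "\<alpha> = {#} \<or> \<beta> = {#}")
  case False
  then have "size (\<alpha> + \<beta>) \<ge> 4" using size_null [of \<alpha>] size_null [of \<beta>] assms by simp
  then show ?thesis using fuse [OF assms, of \<alpha> "{#}"] by simp
qed (use assms in auto)

lemma null_sum: "finite A \<Longrightarrow> (\<And>e. e \<in> A \<Longrightarrow> f e \<in> N) \<Longrightarrow> (\<Sum>e\<in>A. f e) \<in> N"
  by (induction A rule: finite_induct) (auto intro: null_add)

lemma null_mult_right:
  assumes "\<beta> \<in> N" "0 \<notin># \<alpha>"
  shows "gsr_mult \<alpha> \<beta> \<in> N"
  using assms(2) by (induction \<alpha>) (auto intro!: null_add T3 assms(1))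

lemma null_mult_left: "\<beta> \<in> N \<Longrightarrow> 0 \<notin># \<alpha> \<Longrightarrow> gsr_mult \<beta> \<alpha> \<in> N"
  using null_mult_right gsr_mult_commute by metis

lemma self_neg_null: "0 \<notin># \<alpha> \<Longrightarrow> \<alpha> + neg \<alpha> \<in> N"
proof (induction \<alpha>)
  case (add x \<alpha>)
  have "{#x, \<epsilon> * x#} + (\<alpha> + neg \<alpha>) \<in> N"
    using add by (intro null_add [of "{#_, _#}"]) (simp_all add: pair_null_iff)
  then show ?case by (simp add: add_mset_commute)
qed simp

text \<open>Trading the factor \<open>\<gamma>\<close> for \<open>\<beta>\<close>, one summand of \<open>\<eta>\<close> at a time; the size bound
  keeps every intermediate sum within the scope of \<^const>\<open>MSF\<close>.\<close>

lemma swap_factor: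
  assumes "A + gsr_mult \<gamma> \<eta> \<in> N" "\<gamma> \<notin> N" "\<beta> + neg \<gamma> \<in> N" "0 \<notin># \<eta>"
    "size A + size \<beta> + size \<eta> \<ge> 5"
  shows "A + gsr_mult \<beta> \<eta> \<in> N"
  using assms(1,4,5)
proof (induction \<eta> arbitrary: A)
  case (add y \<eta>)
  have y: "y \<noteq> 0" using add.prems by auto
  have b: "\<beta> \<noteq> {#}" using assms by auto
  have g: "\<gamma> \<noteq> {#}" using assms by auto
  have bs: "size \<beta> \<ge> 1" using b by (simp add: Suc_le_eq nonempty_has_size)
  have gs: "size (gsr_mult \<gamma> \<eta>) \<ge> size \<eta>" using g by (simp add: Suc_le_eq nonempty_has_size)
  have "(A + gsr_act y \<beta>) + gsr_mult \<gamma> \<eta> \<in> N"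
  proof (rule fuse)
    show "A + gsr_mult \<gamma> (add_mset y \<eta>) \<in> N" by fact
    show "gsr_act y (\<beta> + neg \<gamma>) \<in> N" using T3 y assms by blast
    show "A + gsr_mult \<gamma> (add_mset y \<eta>) = (A + gsr_mult \<gamma> \<eta>) + gsr_act y \<gamma>" by simp
    show "gsr_act y (\<beta> + neg \<gamma>) = gsr_act y \<beta> + neg (gsr_act y \<gamma>)"
      by (simp add: mult.commute)
    show "gsr_act y \<gamma> = {#} \<or> gsr_act y \<gamma> \<notin> N"
      using act_null_iff y assms by blast
    show "4 \<le> size (A + gsr_act y \<beta> + gsr_mult \<gamma> \<eta>)"
      using add.prems(3) gs unfolding size_union size_gsr_act size_add_mset by linarith
  qed simp
  then have "(A + gsr_act y \<beta>) + gsr_mult \<beta> \<eta> \<in> N"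
    by (rule add.IH) (use add.prems bs in auto)
  then show ?case by (simp add: ac_simps)
qed simp


section \<open>Domination between units\<close>

text \<open>Absorption of \<open>p\<close> by null sums containing \<open>q\<close>. The bound on
  \<open>t\<close> leaves out the pair of \<open>q\<close> and \<open>\<epsilon> * q\<close>, whose
  extension by \<open>p\<close> has three terms and is out of reach of \<open>MSF\<close>.\<close>

definition below :: "'a \<Rightarrow> 'a \<Rightarrow> bool" where
  "below p q \<longleftrightarrow> (\<forall>t. size t \<ge> 2 \<longrightarrow> add_mset q t \<in> N \<longrightarrow> add_mset p (add_mset q t) \<in> N)"

lemma belowD: "below p q \<Longrightarrow> add_mset q t \<in> N \<Longrightarrow> size t \<ge> 2 \<Longrightarrow> add_mset p (add_mset q t) \<in> N"
  by (simp add: below_def)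

lemma below_mem:
  assumes "below p q" "q \<in># s" "s \<in> N" "size s \<ge> 3"
  shows "add_mset p s \<in> N"
proof -
  obtain t where "s = add_mset q t" using assms by (meson mset_add)
  then show ?thesis using assms belowD by auto
qed

lemma below_scale:
  assumes "below p q" "a \<noteq> 0"
  shows "below (a * p) (a * q)"
  unfolding below_def
proof (intro allI impI)
  fix t assume t: "2 \<le> size t" "add_mset (a * q) t \<in> N"
  obtain b where b: "b \<noteq> 0" "a * b = 1" "\<And>x. b * (a * x) = x"
    using assms unit_inverse by metis
  have "add_mset q (gsr_act b t) \<in> N" using T3 [OF b(1) t(2)] b by simp
  then have "add_mset p (add_mset q (gsr_act b t)) \<in> N"
    using assms t by (intro belowD) auto
  from T3 [OF assms(2) this] b show "add_mset (a * p) (add_mset (a * q) t) \<in> N"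
    by simp
qed

text \<open>The null triple lets fusion trade \<open>q\<close> for \<open>p + q\<close>.\<close>

lemma below_triple:
  assumes "{#p, q, \<epsilon> * q#} \<in> N"
  shows "below p q"
  unfolding below_def
proof (intro allI impI)
  fix t assume t: "2 \<le> size t" "add_mset q t \<in> N"
  show "add_mset p (add_mset q t) \<in> N"
    by (rule fuse [OF t(2) assms, of t "{#q#}" "{#p, q#}"]) (use t in \<open>auto simp: add_mset_commute\<close>)
qed

text \<open>Fusion trades \<open>q\<close> for \<open>neg R\<close>, and then \<open>neg R\<close>
  for \<open>p + q\<close>. The size bound requires two terms in \<open>R\<close>; a single term can
  only be \<open>\<epsilon> * q\<close>, where \<open>below_triple\<close> applies.\<close>

lemma below_of_rest:
  assumes "R \<notin> N" "add_mset q R \<in> N" "add_mset p (add_mset q R) \<in> N"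
  shows "below p q"
proof (cases "size R \<ge> 2")
  case True
  show ?thesis unfolding below_def
  proof (intro allI impI)
    fix t assume t: "2 \<le> size t" "add_mset q t \<in> N"
    have "neg (add_mset q R) \<in> N" using assms(2) by (rule neg_null)
    then have 1: "t + neg R \<in> N"
      by (rule fuse [OF t(2), of _ t "{#q#}" "neg R"]) (use t True in auto)
    show "add_mset p (add_mset q t) \<in> N"
      by (rule fuse [OF 1 assms(3), of t "neg R" "{#p, q#}"]) (use t True assms in auto)
  qed
next
  case False
  have "R \<noteq> {#}" using assms by auto
  then have "size R = 1" using False by (metis One_nat_def Suc_1 less_2_cases not_le size_eq_0_iff_empty)
  then obtain r where "R = {#r#}" using size_1_singleton_mset by blast
  then have "R = {#\<epsilon> * q#}" using assms by (simp add: pair_null_iff)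
  then show ?thesis using assms below_triple by simp
qed

text \<open>Two trades: \<open>\<epsilon> * q\<close> becomes the non-null sum \<open>p + R\<close>,
  which collapses to \<open>p\<close> because \<open>R\<close> is null. Sign invariance and
  transitivity of \<open>below\<close> use it with \<open>\<alpha> = R\<close>.\<close>

lemma replace_negative:
  assumes "R \<in> N" "add_mset p R \<notin> N" "add_mset p (add_mset q R) \<in> N"
    "add_mset (\<epsilon> * q) \<alpha> \<in> N" "size \<alpha> \<ge> 3"
  shows "add_mset p \<alpha> \<in> N"
proof -
  have 1: "\<alpha> + add_mset p R \<in> N"
    by (rule fuse [OF assms(4,3), of \<alpha> "{#\<epsilon> * q#}" "add_mset p R"]) (use assms in auto)
  have "p \<noteq> 0" using assms(3) null_nonzero by simp
  then have 2: "{#p#} + neg (add_mset p R) \<in> N"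
    using null_add [of "{#p, \<epsilon> * p#}" "neg R"] assms by (simp add: pair_null_iff add_mset_commute)
  show ?thesis
    by (rule fuse [OF 1 2, of \<alpha> "add_mset p R" "{#p#}"]) (use assms in auto)
qed

text \<open>A maximal non-null subsum \<open>R\<close> misses at least two summands \<open>u\<close>, \<open>v\<close>, and
  \<open>R + u\<close>, \<open>R + v\<close>, \<open>R + u + v\<close> are all null.\<close>

lemma below_refl_of_removable:
  assumes "T \<in> N" "T \<noteq> {#}" "\<And>p. p \<in># T \<Longrightarrow> T - {#p#} \<in> N"
  shows "below 1 1"
proof -
  define P where "P = (\<lambda>R. R \<subseteq># T \<and> R \<notin> N)"
  obtain p where "p \<in># T" using assms by blast
  then have "P {#p#}" by (simp add: P_def)
  moreover have "size R < Suc (size T)" if "P R" for R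
    using that by (simp add: P_def size_mset_mono less_Suc_eq_le)
  ultimately obtain R where R: "P R" and max: "\<And>R'. P R' \<Longrightarrow> size R' \<le> size R"
    using ex_has_greatest_nat [of P _ size "Suc (size T)"] by (metis less_imp_le)
  have bigger: "R + U \<in> N" if "U \<noteq> {#}" "R + U \<subseteq># T" for U
  proof (rule ccontr)
    assume "R + U \<notin> N"
    then have "size (R + U) \<le> size R" using that by (intro max) (simp add: P_def)
    then show False using that by (simp add: nonempty_has_size)
  qed
  obtain Q where Q: "T = R + Q" using R by (auto simp: P_def subset_mset.le_iff_add)
  have "Q \<noteq> {#}" using Q R assms by (auto simp: P_def)
  then obtain u Q' where Q': "Q = add_mset u Q'" by (meson multiset_cases)
  \<comment> \<open>Deleting \<open>u\<close> from \<open>T\<close> leaves a null sum, so the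
    non-null \<open>R\<close> cannot be all of it, and a second missing term exists.\<close>
  have "T - {#u#} = R + Q'" using Q Q' by simp
  then have "R + Q' \<in> N" using assms(3) [of u] Q Q' by simp
  then have "Q' \<noteq> {#}" using R by (auto simp: P_def)
  then obtain v Q'' where Q'': "Q' = add_mset v Q''" by (meson multiset_cases)
  have T: "T = R + {#u, v#} + Q''" using Q Q' Q'' by simp
  have sub: "R + {#u#} \<subseteq># T" "R + {#v#} \<subseteq># T" "R + {#u, v#} \<subseteq># T"
    unfolding T by (simp_all add: subseteq_mset_def)
  have Ru: "add_mset u R \<in> N" and Rv: "add_mset v R \<in> N"
    and Ruv: "add_mset v (add_mset u R) \<in> N" and RN: "R \<notin> N"
    using bigger [OF _ sub(1)] bigger [OF _ sub(2)] bigger [OF _ sub(3)] R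
    by (simp_all add: P_def add_mset_commute)
  have vu: "below v u" by (rule below_of_rest [OF RN Ru Ruv])
  have "size R \<ge> 1" using RN by (cases R) auto
  have "u \<noteq> 0" using Ru null_nonzero by simp
  \<comment> \<open>After absorbing \<open>v\<close>, the sum trades \<open>v\<close> for
    \<open>neg R\<close>, and then \<open>neg R\<close> for \<open>u\<close>.\<close>
  have "below u u" unfolding below_def
  proof (intro allI impI)
    fix t assume t: "2 \<le> size t" "add_mset u t \<in> N"
    have 0: "add_mset v (add_mset u t) \<in> N" using vu t belowD by blast
    have "neg (add_mset v R) \<in> N" using Rv by (rule neg_null)
    then have 1: "add_mset u t + neg R \<in> N"
      by (rule fuse [OF 0, of _ "add_mset u t" "{#v#}" "neg R"]) (use t RN \<open>size R \<ge> 1\<close> in auto)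
    show "add_mset u (add_mset u t) \<in> N"
      by (rule fuse [OF 1 Ru, of "add_mset u t" "neg R" "{#u#}"]) (use t RN in auto)
  qed
  obtain b where b: "b \<noteq> 0" "b * u = 1" using \<open>u \<noteq> 0\<close> unit_inverse by metis
  from below_scale [OF \<open>below u u\<close> b(1)] b show ?thesis by simp
qed

end

section \<open>Absorption as a total preorder on the units, once \<open>1\<close> absorbs
  itself\<close>

locale reflexive_msf_tract = msf_tract +
  assumes below_one: "below 1 1"
begin

lemma below_refl: "q \<noteq> 0 \<Longrightarrow> below q q"
  using below_scale [OF below_one, of q] by simp

text \<open>To a null \<open>t\<close> a cancelling pair is added. Otherwise reflexivity makes
  \<open>q + q + t\<close> null; fusing with \<open>neg (q + t)\<close>, first along
  \<open>q\<close> and then along \<open>t\<close>, gives \<open>q + \<epsilon> * q + neg t\<close>,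
  and negation finishes.\<close>

lemma below_neg_self:
  assumes "q \<noteq> 0"
  shows "below (\<epsilon> * q) q"
  unfolding below_def
proof (intro allI impI)
  fix t assume t: "2 \<le> size t" "add_mset q t \<in> N"
  show "add_mset (\<epsilon> * q) (add_mset q t) \<in> N"
  proof (cases "t \<in> N")
    case True
    then have "{#q, \<epsilon> * q#} + t \<in> N" using assms by (intro null_add) (auto simp: pair_null_iff)
    then show ?thesis by (simp add: add_mset_commute)
  next
    case False
    have n: "neg (add_mset q t) \<in> N" using t(2) by (rule neg_null)
    have 1: "add_mset q (add_mset q t) \<in> N" using below_refl assms t belowD by blast
    have 2: "add_mset q t + neg t \<in> N"
      by (rule fuse [OF 1 n, of "add_mset q t" "{#q#}" "neg t"]) (use t in auto)
    have 3: "add_mset (\<epsilon> * q) (add_mset q (neg t)) \<in> N"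
      by (rule fuse [OF 2 n, of "add_mset q (neg t)" t "{#\<epsilon> * q#}"]) (use t False in \<open>auto simp: ac_simps\<close>)
    then have "neg (add_mset (\<epsilon> * q) (add_mset q (neg t))) \<in> N" by (rule neg_null_iff [THEN iffD2])
    then show ?thesis by (simp add: add_mset_commute)
  qed
qed

text \<open>For \<open>R = \<epsilon> * q + t\<close>, the sums \<open>q + R\<close>, hence
  \<open>p + q + R\<close>, and \<open>\<epsilon> * q + R\<close> are null; were
  \<open>p + R\<close> not null, \<open>replace_negative\<close> would make it so.\<close>

lemma below_neg_right:
  assumes "below p q" "q \<noteq> 0"
  shows "below p (\<epsilon> * q)"
  unfolding below_def
proof (intro allI impI)
  fix t assume t: "2 \<le> size t" "add_mset (\<epsilon> * q) t \<in> N"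
  show "add_mset p (add_mset (\<epsilon> * q) t) \<in> N"
  proof (rule ccontr)
    assume no: "add_mset p (add_mset (\<epsilon> * q) t) \<notin> N"
    have "below q (\<epsilon> * q)" using below_neg_self [of "\<epsilon> * q"] assms by simp
    then have 1: "add_mset q (add_mset (\<epsilon> * q) t) \<in> N" using t belowD by blast
    have 2: "add_mset p (add_mset q (add_mset (\<epsilon> * q) t)) \<in> N"
      using belowD [OF assms(1) 1] t by simp
    have 3: "add_mset (\<epsilon> * q) (add_mset (\<epsilon> * q) t) \<in> N"
      using belowD [OF below_refl t(2)] assms t by simp
    show False using replace_negative [OF t(2) no 2 3] t no by simp
  qed
qed

lemma below_neg_left:
  assumes "below p q" "q \<noteq> 0"
  shows "below (\<epsilon> * p) q"
  using below_scale [OF below_neg_right [OF assms], of \<epsilon>] by simp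

text \<open>The argument of \<open>below_neg_right\<close> with \<open>R = r + t\<close>: this sum
  absorbs both \<open>q\<close> and \<open>\<epsilon> * q\<close>, and \<open>q + R\<close> absorbs
  \<open>p\<close>.\<close>

lemma below_trans:
  assumes "below p q" "below q r" "r \<noteq> 0"
  shows "below p r"
  unfolding below_def
proof (intro allI impI)
  fix t assume t: "2 \<le> size t" "add_mset r t \<in> N"
  show "add_mset p (add_mset r t) \<in> N"
  proof (rule ccontr)
    assume no: "add_mset p (add_mset r t) \<notin> N"
    have 1: "add_mset q (add_mset r t) \<in> N" using belowD [OF assms(2) t(2,1)] .
    have 2: "add_mset p (add_mset q (add_mset r t)) \<in> N"
      using belowD [OF assms(1) 1] t by simp
    have 3: "add_mset (\<epsilon> * q) (add_mset r t) \<in> N"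
      using belowD [OF below_neg_left [OF assms(2,3)] t(2,1)] .
    show False using replace_negative [OF t(2) no 2 3] t no by simp
  qed
qed

text \<open>Split \<open>q\<close> off \<open>V\<close>. If the rest \<open>R\<close> is not null,
  \<open>below_of_rest\<close> applies; if \<open>R\<close> and \<open>p + R\<close> are both null,
  the induction does. If only \<open>R\<close> is null, any \<open>q + t\<close> absorbs
  \<open>\<epsilon> * q\<close>, which \<open>replace_negative\<close> turns into
  \<open>p\<close>.\<close>

lemma null_extension_below:
  assumes "V \<in> N" "add_mset p V \<in> N"
  shows "\<exists>q\<in>#V. below p q"
  using assms
proof (induction "size V" arbitrary: V rule: less_induct)
  case less
  have "V \<noteq> {#}" using less.prems by auto
  then obtain q R where V: "V = add_mset q R" by (meson multiset_cases)
  have q: "q \<noteq> 0" using less.prems(1) V null_nonzero by simp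
  show ?case
  proof (cases "R \<in> N")
    case False
    then show ?thesis using below_of_rest [OF False] less.prems V by auto
  next
    case R: True
    show ?thesis
    proof (cases "add_mset p R \<in> N")
      case True
      then show ?thesis using less.hyps [of R] R V by auto
    next
      case False
      have "below p q" unfolding below_def
      proof (intro allI impI)
        fix t assume t: "2 \<le> size t" "add_mset q t \<in> N"
        have "add_mset (\<epsilon> * q) (add_mset q t) \<in> N" using belowD [OF below_neg_self [OF q] t(2,1)] .
        then show "add_mset p (add_mset q t) \<in> N"
          using replace_negative [OF R False] less.prems V t by simp
      qed
      then show ?thesis using V by auto
    qed
  qed
qed

lemma below_of_alternating:
  assumes "q \<noteq> 0" "{#p, q, \<epsilon> * q, q, \<epsilon> * q#} \<in> N"
  shows "below p q"
proof -
  have "{#q, \<epsilon> * q#} + {#q, \<epsilon> * q#} \<in> N"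
    using assms by (intro null_add) (auto simp: pair_null_iff)
  then have "\<exists>r\<in>#{#q, \<epsilon> * q, q, \<epsilon> * q#}. below p r"
    using assms by (intro null_extension_below) (auto simp: add_mset_commute)
  then have "below p q \<or> below p (\<epsilon> * q)" by auto
  then show ?thesis using below_neg_right [of p "\<epsilon> * q"] assms by auto
qed

lemma below_total:
  assumes "p \<noteq> 0" "q \<noteq> 0"
  shows "below p q \<or> below q p"
proof (cases "{#q, p, \<epsilon> * p, p, \<epsilon> * p#} \<in> N")
  case True
  then show ?thesis using below_of_alternating assms by blast
next
  case False
  have pp: "{#p, \<epsilon> * p#} \<in> N" and qq: "{#q, \<epsilon> * q#} \<in> N"
    using assms by (auto simp: pair_null_iff)
  have p4: "{#p, \<epsilon> * p, p, \<epsilon> * p#} \<in> N"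
    using null_add [OF pp pp] by simp
  have q4: "{#q, \<epsilon> * q, q, \<epsilon> * q#} \<in> N"
    using null_add [OF qq qq] by simp
  have "add_mset p {#p, \<epsilon> * p, p, \<epsilon> * p#} \<in> N"
    by (rule belowD [OF below_refl]) (use assms p4 in auto)
  from null_add [OF qq this]
  have 1: "{#q, \<epsilon> * q, p, p, \<epsilon> * p, p, \<epsilon> * p#} \<in> N" by (simp add: add_mset_commute)
  have 2: "{#q, \<epsilon> * q, q, \<epsilon> * q#} + {#p, \<epsilon> * p, p, \<epsilon> * p#} \<in> N"
    using null_add [OF q4 p4] .
  \<comment> \<open>The connecting sum is the one assumed non-null in this case. What remains of the
    two null sums is the alternating sum of \<open>q\<close> with \<open>p\<close> added.\<close>
  have "{#p, q, \<epsilon> * q, q, \<epsilon> * q#} \<in> N"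
    by (rule fuse [OF 1 2, of "{#\<epsilon> * q, p#}" "{#q, p, \<epsilon> * p, p, \<epsilon> * p#}" "{#q, q, \<epsilon> * q#}"])
      (use False in \<open>simp_all add: add_mset_commute\<close>)
  then show ?thesis using below_of_alternating assms by blast
qed

lemma ex_below_max:
  assumes "T \<noteq> {#}" "0 \<notin># T"
  shows "\<exists>p\<in>#T. \<forall>q\<in>#T. below q p"
  using assms
proof (induction T)
  case (add x T)
  show ?case
  proof (cases "T = {#}")
    case True
    then show ?thesis using add below_refl by auto
  next
    case False
    then obtain p where p: "p \<in># T" "\<forall>q\<in>#T. below q p" using add by auto
    have nz: "p \<noteq> 0" "x \<noteq> 0" using add.prems p by auto
    show ?thesis
    proof (cases "below x p")
      case True
      then show ?thesis using p by auto
    next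
      case False
      then have "below p x" using below_total nz by blast
      then show ?thesis using p below_trans below_refl nz by auto
    qed
  qed
qed simp

lemma null_add_dominated_large:
  assumes "V \<in> N" "q \<in># V" "size V \<ge> 3" "\<And>p. p \<in># P \<Longrightarrow> below p q"
  shows "V + P \<in> N"
  using assms(4)
proof (induction P)
  case (add p P)
  then have "add_mset p (V + P) \<in> N"
    using assms by (intro below_mem [of p q]) auto
  then show ?case by simp
qed (use assms in simp)

text \<open>The pair \<open>q\<close>, \<open>\<epsilon> * q\<close> is too short for
  \<open>below\<close>, so \<open>p\<close> and \<open>r\<close> must enter together. If
  \<open>q + q + \<epsilon> * q\<close> is not null, they are added to the four-term alternating
  sum, and fusion along the negative of that triple removes the surplus pair.\<close>

lemma null_add_dominated_pair:
  assumes "q \<noteq> 0" "below p q" "below r q"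
  shows "{#q, \<epsilon> * q, p, r#} \<in> N"
proof -
  have qq: "{#q, \<epsilon> * q#} \<in> N" using assms by (auto simp: pair_null_iff)
  have q4: "{#q, \<epsilon> * q, q, \<epsilon> * q#} \<in> N" using null_add [OF qq qq] by simp
  show ?thesis
  proof (cases "{#q, q, \<epsilon> * q#} \<in> N")
    case True
    show ?thesis
    proof (cases "{#p, q, \<epsilon> * q#} \<in> N")
      case pN: True
      have "add_mset r {#p, q, \<epsilon> * q#} \<in> N"
        by (rule below_mem [OF assms(3)]) (use pN in auto)
      then show ?thesis by (simp add: add_mset_commute)
    next
      case False
      have 1: "add_mset p {#q, q, \<epsilon> * q#} \<in> N"
        by (rule below_mem [OF assms(2)]) (use True in auto)
      have "neg {#q, q, \<epsilon> * q#} \<in> N" using True by (simp only: neg_null_iff)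
      then have "{#q, \<epsilon> * q, \<epsilon> * q#} \<in> N" by (simp add: add_mset_commute)
      then have 2: "add_mset r {#q, \<epsilon> * q, \<epsilon> * q#} \<in> N"
        by (rule below_mem [OF assms(3), rotated]) auto
      have "add_mset p {#r, q, \<epsilon> * q#} \<in> N"
        by (rule replace_negative [OF qq False, of q])
          (use 1 2 in \<open>simp_all add: add_mset_commute\<close>)
      then show ?thesis by (simp add: add_mset_commute)
    qed
  next
    case False
    have "{#q, \<epsilon> * q, q, \<epsilon> * q#} + {#p, r#} \<in> N"
      by (rule null_add_dominated_large [OF q4, of q]) (use assms in auto)
    then show ?thesis
      by (rule fuse [OF _ q4, of _ "{#p, r, q#}" "neg {#q, q, \<epsilon> * q#}" "{#\<epsilon> * q#}"])
        (use False in \<open>simp_all only: neg_null_iff, simp_all add: add_mset_commute\<close>)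
  qed
qed

lemma null_add_dominated:
  assumes "V \<in> N" "q \<in># V" "size (V + P) \<ge> 4" "\<And>p. p \<in># P \<Longrightarrow> below p q"
  shows "V + P \<in> N"
proof (cases "size V \<ge> 3")
  case True
  then show ?thesis using null_add_dominated_large assms by blast
next
  case False
  obtain V' where V': "V = add_mset q V'" using assms by (meson mset_add)
  have "size V \<ge> 2" using assms(1,2) by (intro size_null) auto
  then have "size V' = 1" using False V' by simp
  then obtain x where "V' = {#x#}" using size_1_singleton_mset by blast
  then have V: "V = {#q, \<epsilon> * q#}" and q: "q \<noteq> 0"
    using V' assms(1) by (auto simp: pair_null_iff)
  then obtain p P' where P: "P = add_mset p P'" using assms(3)
    by (cases P) auto
  then obtain r P'' where P': "P' = add_mset r P''" using assms(3) V
    by (cases P') auto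
  have "{#q, \<epsilon> * q, p, r#} \<in> N"
    by (rule null_add_dominated_pair) (use q P P' assms in auto)
  then have "{#q, \<epsilon> * q, p, r#} + P'' \<in> N"
    by (rule null_add_dominated_large [where q = q]) (use assms P P' in auto)
  then show ?thesis using V P P' by (simp add: ac_simps)
qed

end

section \<open>Orthogonality to families of vectors\<close>

text \<open>\<open>dot\<close> without the involution, which makes it symmetric in its two
  vectors.\<close>

definition pairing :: "'e set \<Rightarrow> ('e \<Rightarrow> 'a::times multiset) \<Rightarrow> ('e \<Rightarrow> 'a multiset) \<Rightarrow> 'a multiset" where
  "pairing E X Y = (\<Sum>e\<in>E. gsr_mult (X e) (Y e))"

abbreviation vec :: "('e \<Rightarrow> 'a::zero) \<Rightarrow> 'e \<Rightarrow> 'a multiset" where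
  "vec D \<equiv> \<lambda>e. gsr_of (D e)"

lemma pairing_commute:
  fixes X :: "'e \<Rightarrow> 'a::comm_monoid_mult multiset"
  shows "pairing E X Y = pairing E Y X"
  by (simp add: pairing_def gsr_mult_commute)

lemma pairing_subset:
  assumes "finite E" "W \<subseteq> E" "\<And>e. e \<in> E \<Longrightarrow> e \<notin> W \<Longrightarrow> X e = {#} \<or> Y e = {#}"
  shows "pairing E X Y = pairing W X Y"
  unfolding pairing_def
  by (rule sum.mono_neutral_right) (use assms in \<open>auto dest: assms(3)\<close>)

lemma pairing_remove:
  "finite E \<Longrightarrow> e \<in> E \<Longrightarrow> pairing E X Y = gsr_mult (X e) (Y e) + pairing (E - {e}) X Y"
  by (simp add: pairing_def sum.remove)

lemma pairing_upd:
  assumes "finite E" "e \<in> E"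
  shows "pairing E (X(e := \<alpha>)) Y = gsr_mult \<alpha> (Y e) + pairing (E - {e}) X Y"
proof -
  have "pairing (E - {e}) (X(e := \<alpha>)) Y = pairing (E - {e}) X Y"
    by (simp add: pairing_def)
  then show ?thesis using assms by (simp add: pairing_remove)
qed

lemma pairing_scaled:
  fixes X :: "'e \<Rightarrow> 'a::comm_monoid_mult multiset"
  assumes "finite E" "\<And>e. e \<in> E \<Longrightarrow> X e = {#} \<or> Y e = gsr_act k (Z e)"
  shows "pairing E X Y = gsr_act k (pairing E X Z)"
  unfolding pairing_def gsr_act_sum [OF assms(1)]
  by (rule sum.cong) (use assms(2) in \<open>force simp: gsr_mult_act_right\<close>)+

lemma pairing_singleton [simp]: "pairing {e} X Y = gsr_mult (X e) (Y e)"
  by (simp add: pairing_def)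

lemma pairing_doubleton:
  "e \<noteq> f \<Longrightarrow> pairing {e, f} X Y = gsr_mult (X e) (Y e) + gsr_mult (X f) (Y f)"
  by (simp add: pairing_def)

definition msupp :: "'e set \<Rightarrow> ('e \<Rightarrow> 'a multiset) \<Rightarrow> 'e set" where
  "msupp E X = {e \<in> E. X e \<noteq> {#}}"

lemma gsr_of_eq_empty [simp]: "gsr_of x = {#} \<longleftrightarrow> x = 0"
  by (simp add: gsr_of_def)

lemma msupp_vec [simp]: "msupp E (vec D) = supp E D"
  by (auto simp: msupp_def supp_def)

context msf_tract
begin

lemma pairing_not_singleton:
  assumes "finite E" "pairing E X Y \<in> N" "msupp E X \<inter> msupp E Y = {e}"
  shows "size (X e) * size (Y e) \<noteq> 1"
proof
  assume *: "size (X e) * size (Y e) = 1"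
  have "pairing E X Y = pairing {e} X Y"
    by (rule pairing_subset) (use assms in \<open>auto simp: msupp_def\<close>)
  then have "size (pairing E X Y) = 1" using * by simp
  then show False using assms size_1_singleton_mset by fastforce
qed

text \<open>Each term of a null pair determines the other, so \<open>V\<close> prescribes the ratio
  of the entries at \<open>e\<close> and \<open>f\<close>, the same for \<open>U\<close> and for
  \<open>X\<close>.\<close>

lemma proportional_entry:
  assumes "finite E" "e \<noteq> f"
    and U: "pairing E (vec U) (vec V) \<in> N" "supp E U \<inter> supp E V = {e, f}"
    and X: "pairing E X (vec V) \<in> N" "msupp E X \<inter> supp E V = {e, f}"
    and Xe: "X e = {#k * U e#}" and Xf: "X f = {#z#}"
  shows "z = k * U f"
proof -
  have nz: "U e \<noteq> 0" "U f \<noteq> 0" "V e \<noteq> 0" "V f \<noteq> 0"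
    using U(2) by (auto simp: supp_def)
  have "pairing E (vec U) (vec V) = pairing {e, f} (vec U) (vec V)"
    by (rule pairing_subset) (use assms in \<open>auto simp: supp_def\<close>)
  then have 1: "V f * U f = \<epsilon> * (U e * V e)"
    using U(1) nz by (simp add: pairing_doubleton assms(2) gsr_of_nonzero pair_null_iff ac_simps)
  have "pairing E X (vec V) = pairing {e, f} X (vec V)"
    by (rule pairing_subset) (use assms in \<open>auto simp: supp_def msupp_def\<close>)
  then have "V f * z = \<epsilon> * (V e * (k * U e))"
    using X(1) nz Xe Xf by (simp add: pairing_doubleton assms(2) gsr_of_nonzero pair_null_iff)
  also have "\<dots> = k * (V f * U f)" unfolding 1 by (simp add: ac_simps)
  also have "\<dots> = V f * (k * U f)" by (simp add: ac_simps)
  finally show ?thesis using unit_inverse nz(4) by metis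
qed

end

text \<open>The dichotomy is the only property of circuits and cocircuits that is needed.\<close>

locale dual_families = msf_tract N
  for N :: "'a::{comm_monoid_mult, mult_zero} multiset set" +
  fixes E :: "'e set" and CC DD :: "('e \<Rightarrow> 'a) set"
  assumes finite_E: "finite E"
    and orthogonal: "C \<in> CC \<Longrightarrow> D \<in> DD \<Longrightarrow> pairing E (vec C) (vec D) \<in> N"
    and dichotomy: "S \<subseteq> E \<Longrightarrow> e \<in> S \<Longrightarrow>
      (\<exists>C\<in>CC. supp E C \<inter> S = {e}) \<or> (\<exists>D\<in>DD. e \<in> supp E D \<and> supp E D \<subseteq> S)"
begin

lemma circuit_cocircuit_not_single:
  assumes "C \<in> CC" "D \<in> DD"
  shows "supp E C \<inter> supp E D \<noteq> {e}"
proof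
  assume *: "supp E C \<inter> supp E D = {e}"
  then have "C e \<noteq> 0" "D e \<noteq> 0" by (auto simp: supp_def)
  then show False
    using pairing_not_singleton [OF finite_E orthogonal [OF assms], of e] *
    by (simp add: gsr_of_nonzero)
qed

text \<open>Requiring \<open>X\<close> to be orthogonal only to the members of \<open>DD\<close> supported in \<open>Y\<close>
  amounts to contracting the zero set of \<open>Y\<close>.\<close>

definition admissible :: "('e \<Rightarrow> 'a multiset) \<Rightarrow> ('e \<Rightarrow> 'a multiset) \<Rightarrow> bool" where
  "admissible X Y \<longleftrightarrow> (\<forall>e\<in>E. 0 \<notin># X e \<and> 0 \<notin># Y e) \<and>
     (\<forall>D\<in>DD. supp E D \<subseteq> msupp E Y \<longrightarrow> pairing E X (vec D) \<in> N) \<and>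
     (\<forall>C\<in>CC. pairing E Y (vec C) \<in> N)"

lemma admissibleD:
  assumes "admissible X Y"
  shows "e \<in> E \<Longrightarrow> 0 \<notin># X e" "e \<in> E \<Longrightarrow> 0 \<notin># Y e"
    "D \<in> DD \<Longrightarrow> supp E D \<subseteq> msupp E Y \<Longrightarrow> pairing E X (vec D) \<in> N"
    "C \<in> CC \<Longrightarrow> pairing E Y (vec C) \<in> N"
  using assms by (auto simp: admissible_def)

section \<open>Loops, coloops and pairings of at most three terms\<close>

lemma loop_entry_null:
  assumes "admissible X Y" "C \<in> CC" "supp E C \<inter> msupp E Y = {e}"
  shows "Y e \<in> N"
proof -
  have "C e \<noteq> 0" using assms by (auto simp: supp_def)
  have "pairing E Y (vec C) = pairing {e} Y (vec C)"
    by (rule pairing_subset) (use assms finite_E in \<open>auto simp: supp_def msupp_def\<close>)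
  then have "gsr_act (C e) (Y e) \<in> N"
    using admissibleD(4) [OF assms(1,2)] \<open>C e \<noteq> 0\<close> by (simp add: gsr_of_nonzero)
  then show ?thesis using act_null_iff \<open>C e \<noteq> 0\<close> by blast
qed

text \<open>Dual to \<open>loop_entry_null\<close>: the pairing with \<open>D\<close> is a unit
  multiple of \<open>X e\<close>. In matroid terms, \<open>e\<close> is a coloop after contracting
  the zeros of \<open>Y\<close> and restricting to the support of \<open>X\<close>.\<close>

lemma coloop_entry_null:
  assumes "admissible X Y" "D \<in> DD" "supp E D \<subseteq> msupp E Y" "supp E D \<inter> msupp E X = {e}"
  shows "X e \<in> N"
proof -
  have "D e \<noteq> 0" using assms by (auto simp: supp_def)
  have "pairing E X (vec D) = pairing {e} X (vec D)"
    by (rule pairing_subset) (use assms finite_E in \<open>auto simp: supp_def msupp_def\<close>)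
  then have "gsr_act (D e) (X e) \<in> N"
    using admissibleD(3) [OF assms(1-3)] \<open>D e \<noteq> 0\<close> by (simp add: gsr_of_nonzero)
  then show ?thesis using act_null_iff \<open>D e \<noteq> 0\<close> by blast
qed

lemma null_of_proportional_cocircuit:
  assumes "admissible X Y" "D \<in> DD" "supp E D \<subseteq> msupp E Y" "k \<noteq> 0"
    "\<And>g. g \<in> msupp E X \<inter> msupp E Y \<Longrightarrow> Y g = {#k * D g#}"
  shows "pairing E X Y \<in> N"
proof -
  have "X g = {#} \<or> Y g = gsr_act k (vec D g)" if "g \<in> E" for g
  proof (cases "Y g = {#}")
    case True
    then show ?thesis using assms(3) that by (auto simp: msupp_def supp_def)
  next
    case False
    then show ?thesis
      using assms(5) [of g] that admissibleD(2) [OF assms(1) that]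
      by (cases "X g = {#}"; cases "D g = 0") (auto simp: msupp_def gsr_of_nonzero)
  qed
  then have "pairing E X Y = gsr_act k (pairing E X (vec D))"
    by (rule pairing_scaled [OF finite_E])
  then show ?thesis using T3 assms(4) admissibleD(3) [OF assms(1-3)] by simp
qed

lemma null_of_proportional_circuit:
  assumes "admissible X Y" "C \<in> CC" "supp E C \<inter> msupp E Y \<subseteq> msupp E X" "k \<noteq> 0"
    "\<And>g. g \<in> msupp E X \<inter> msupp E Y \<Longrightarrow> X g = {#k * C g#}"
  shows "pairing E X Y \<in> N"
proof -
  have "Y g = {#} \<or> X g = gsr_act k (vec C g)" if "g \<in> E" for g
  proof (cases "X g = {#}")
    case True
    then show ?thesis using assms(3) that by (auto simp: msupp_def supp_def)
  next
    case False
    then show ?thesis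
      using assms(5) [of g] that admissibleD(1) [OF assms(1) that]
      by (cases "Y g = {#}"; cases "C g = 0") (auto simp: msupp_def gsr_of_nonzero)
  qed
  then have "pairing E Y X = gsr_act k (pairing E Y (vec C))"
    by (rule pairing_scaled [OF finite_E])
  then show ?thesis using T3 assms(4) admissibleD(4) [OF assms(1,2)]
    by (simp add: pairing_commute)
qed

text \<open>Dichotomy for \<open>msupp E Y - {e}\<close>: a circuit meeting this set only in
  \<open>f\<close> must also contain \<open>e\<close>, by the last assumption.\<close>

lemma pair_dichotomy:
  assumes "e \<in> msupp E Y" "f \<in> msupp E Y" "e \<noteq> f"
    and "\<And>C. C \<in> CC \<Longrightarrow> supp E C \<inter> msupp E Y \<noteq> {f}"
  shows "(\<exists>C\<in>CC. supp E C \<inter> msupp E Y = {e, f}) \<or>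
    (\<exists>D\<in>DD. f \<in> supp E D \<and> supp E D \<subseteq> msupp E Y - {e})"
proof -
  have "msupp E Y - {e} \<subseteq> E" "f \<in> msupp E Y - {e}" using assms by (auto simp: msupp_def)
  from dichotomy [OF this] show ?thesis
  proof
    assume "\<exists>C\<in>CC. supp E C \<inter> (msupp E Y - {e}) = {f}"
    then obtain C where "C \<in> CC" "supp E C \<inter> (msupp E Y - {e}) = {f}" by blast
    then show ?thesis using assms(1) assms(4) [of C] by blast
  qed blast
qed

lemma unit_multiple:
  assumes "y \<noteq> 0" "d \<noteq> 0"
  obtains k where "k \<noteq> 0" "y = k * (d::'a)"
proof -
  obtain b where "b \<noteq> 0" "b * d = 1" using assms unit_inverse by metis
  then have "y * b \<noteq> 0" "y = (y * b) * d" using assms by (auto simp: mult.assoc)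
  then show thesis using that by blast
qed

lemma null_of_two:
  assumes adm: "admissible X Y" and W: "msupp E X \<inter> msupp E Y = {e, f}" "e \<noteq> f"
    and no_loop: "\<And>C g. C \<in> CC \<Longrightarrow> g \<in> {e, f} \<Longrightarrow> supp E C \<inter> msupp E Y \<noteq> {g}"
    and small: "size (pairing E X Y) \<le> 3"
  shows "pairing E X Y \<in> N"
proof -
  have T: "pairing E X Y = gsr_mult (X e) (Y e) + gsr_mult (X f) (Y f)"
    unfolding pairing_doubleton [OF W(2), symmetric]
    by (rule pairing_subset) (use W finite_E in \<open>auto simp: msupp_def\<close>)
  have ef: "e \<in> E" "f \<in> E" "X e \<noteq> {#}" "X f \<noteq> {#}" "Y e \<noteq> {#}" "Y f \<noteq> {#}"
    "e \<in> msupp E Y" "f \<in> msupp E Y"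
    using W by (auto simp: msupp_def)
  show ?thesis
  proof (cases "\<exists>C\<in>CC. supp E C \<inter> msupp E Y = {e, f}")
    case False
    \<comment> \<open>Cocircuits inside \<open>msupp E Y\<close> now separate \<open>e\<close> and
      \<open>f\<close>, so both entries of \<open>X\<close> are null on their own.\<close>
    obtain D where "D \<in> DD" "f \<in> supp E D" "supp E D \<subseteq> msupp E Y - {e}"
      using pair_dichotomy [of e Y f] ef W no_loop False by blast
    then have Xf: "X f \<in> N" using W by (intro coloop_entry_null [OF adm]) auto
    have "\<not> (\<exists>C\<in>CC. supp E C \<inter> msupp E Y = {f, e})" using False by (simp add: insert_commute)
    then obtain D' where "D' \<in> DD" "e \<in> supp E D'" "supp E D' \<subseteq> msupp E Y - {f}"
      using pair_dichotomy [of f Y e] ef W no_loop by blast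
    then have Xe: "X e \<in> N" using W by (intro coloop_entry_null [OF adm]) auto
    show ?thesis unfolding T using Xe Xf adm ef by (intro null_add null_mult_left admissibleD) auto
  next
    case True
    then obtain C where C: "C \<in> CC" "supp E C \<inter> msupp E Y = {e, f}" by blast
    obtain D where D: "D \<in> DD" "e \<in> supp E D" "supp E D \<subseteq> msupp E Y"
      using dichotomy [of "msupp E Y" e] no_loop ef by (auto simp: msupp_def)
    have "f \<in> supp E D" using circuit_cocircuit_not_single [OF C(1) D(1), of e] C D by blast
    then have CD: "supp E C \<inter> supp E D = {e, f}" and DX: "msupp E X \<inter> supp E D = {e, f}"
      using C D W by auto
    have nz: "C e \<noteq> 0" "D e \<noteq> 0" using CD by (auto simp: supp_def)
    have "size (X e) * size (Y e) + size (X f) * size (Y f) \<le> 3"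
      using small unfolding T by simp
    moreover have "size (X e) \<ge> 1" "size (X f) \<ge> 1" "size (Y e) \<ge> 1" "size (Y f) \<ge> 1"
      using ef by (simp_all add: Suc_le_eq nonempty_has_size)
    ultimately consider "size (Y e) = 1" "size (Y f) = 1" | "size (X e) = 1" "size (X f) = 1"
    proof -
      assume *: "size (X e) * size (Y e) + size (X f) * size (Y f) \<le> 3"
        "size (X e) \<ge> 1" "size (X f) \<ge> 1" "size (Y e) \<ge> 1" "size (Y f) \<ge> 1"
      \<comment> \<open>The four sizes therefore add up to at most five, so at most one exceeds one,
        and one of the two vectors has single units at both positions.\<close>
      have prod: "a * b \<ge> a + b - 1" if "a \<ge> 1" "b \<ge> 1" for a b :: nat
        using that by (cases a; cases b) auto
      show thesis
        using that * prod [of "size (X e)" "size (Y e)"] prod [of "size (X f)" "size (Y f)"]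
        by linarith
    qed
    then show ?thesis
    proof cases
      case 1
      then obtain y z where y: "Y e = {#y#}" and z: "Y f = {#z#}"
        by (metis One_nat_def size_1_singleton_mset)
      have "y \<noteq> 0" using admissibleD(2) [OF adm ef(1)] y by simp
      then obtain k where k: "k \<noteq> 0" "y = k * D e" using unit_multiple nz by blast
      have "z = k * D f"
      proof (rule proportional_entry [OF finite_E W(2)])
        show "pairing E (vec D) (vec C) \<in> N"
          using orthogonal [OF C(1) D(1)] by (simp add: pairing_commute)
        show "pairing E Y (vec C) \<in> N" by (rule admissibleD(4) [OF adm C(1)])
      qed (use y z k C CD in auto)
      then show ?thesis
        by (intro null_of_proportional_cocircuit [OF adm D(1,3) k(1)]) (use W y z k in auto)
    next
      case 2
      then obtain x z where x: "X e = {#x#}" and z: "X f = {#z#}"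
        by (metis One_nat_def size_1_singleton_mset)
      have "x \<noteq> 0" using admissibleD(1) [OF adm ef(1)] x by simp
      then obtain k where k: "k \<noteq> 0" "x = k * C e" using unit_multiple nz by blast
      have "z = k * C f"
      proof (rule proportional_entry [OF finite_E W(2)])
        show "pairing E (vec C) (vec D) \<in> N" using orthogonal [OF C(1) D(1)] .
        show "pairing E X (vec D) \<in> N" by (rule admissibleD(3) [OF adm D(1,3)])
      qed (use x z k DX CD in auto)
      then show ?thesis
        by (intro null_of_proportional_circuit [OF adm C(1) _ k(1)]) (use W x z k C in auto)
    qed
  qed
qed

text \<open>Because of \<open>C\<close>, a cocircuit inside \<open>msupp E Y\<close> through
  \<open>g\<close> that avoids \<open>e\<close> would avoid \<open>f\<close> too and make the single
  unit \<open>X g\<close> null. Hence some circuit also has trace \<open>{e, g}\<close>, and the two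
  circuits force \<open>Y\<close> to be proportional to a cocircuit.\<close>

lemma null_of_three_parallel:
  assumes adm: "admissible X Y" and W: "msupp E X \<inter> msupp E Y = {e, f, g}"
    "e \<noteq> f" "e \<noteq> g" "f \<noteq> g"
    and no_loop: "\<And>C h. C \<in> CC \<Longrightarrow> h \<in> {e, f, g} \<Longrightarrow> supp E C \<inter> msupp E Y \<noteq> {h}"
    and single: "\<And>h. h \<in> {e, f, g} \<Longrightarrow> \<exists>x. X h = {#x#}" "\<And>h. h \<in> {e, f, g} \<Longrightarrow> \<exists>y. Y h = {#y#}"
    and C: "C \<in> CC" "supp E C \<inter> msupp E Y = {e, f}"
  shows "pairing E X Y \<in> N"
proof -
  have in_supp: "e \<in> msupp E Y" "f \<in> msupp E Y" "g \<in> msupp E Y" "e \<in> E" using W by (auto simp: msupp_def)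
  have no_coloop: False if "D \<in> DD" "supp E D \<subseteq> msupp E Y" "supp E D \<inter> msupp E X = {h}" for D h
    using coloop_entry_null [OF adm that] single(1) [of h] that W by force
  have "\<not> (\<exists>D\<in>DD. g \<in> supp E D \<and> supp E D \<subseteq> msupp E Y - {e})"
  proof
    assume "\<exists>D\<in>DD. g \<in> supp E D \<and> supp E D \<subseteq> msupp E Y - {e}"
    then obtain D where D: "D \<in> DD" "g \<in> supp E D" "supp E D \<subseteq> msupp E Y - {e}" by blast
    have "f \<notin> supp E D" using circuit_cocircuit_not_single [OF C(1) D(1), of f] C D by blast
    then have "supp E D \<inter> msupp E X = {g}" using W D by blast
    then show False using no_coloop D by blast
  qed
  then obtain C' where C': "C' \<in> CC" "supp E C' \<inter> msupp E Y = {e, g}"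
    using pair_dichotomy [of e Y g] in_supp W no_loop by blast
  obtain D where D: "D \<in> DD" "e \<in> supp E D" "supp E D \<subseteq> msupp E Y"
    using dichotomy [of "msupp E Y" e] no_loop in_supp by (auto simp: msupp_def)
  have "f \<in> supp E D" using circuit_cocircuit_not_single [OF C(1) D(1), of e] C D by blast
  moreover have "g \<in> supp E D" using circuit_cocircuit_not_single [OF C'(1) D(1), of e] C' D by blast
  moreover have "supp E D \<inter> supp E C = supp E D \<inter> {e, f}" using C(2) D(3) by blast
  moreover have "supp E D \<inter> supp E C' = supp E D \<inter> {e, g}" using C'(2) D(3) by blast
  ultimately have CD: "supp E D \<inter> supp E C = {e, f}" "supp E D \<inter> supp E C' = {e, g}"
    using D(2) by simp_all
  obtain y z w where Y: "Y e = {#y#}" "Y f = {#z#}" "Y g = {#w#}"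
    using single(2) [of e] single(2) [of f] single(2) [of g] by auto
  have "y \<noteq> 0" using admissibleD(2) [OF adm in_supp(4)] Y by simp
  moreover have "D e \<noteq> 0" using D by (auto simp: supp_def)
  ultimately obtain k where k: "k \<noteq> 0" "y = k * D e" using unit_multiple by blast
  have "z = k * D f"
  proof (rule proportional_entry [OF finite_E W(2)])
    show "pairing E (vec D) (vec C) \<in> N"
      using orthogonal [OF C(1) D(1)] by (simp add: pairing_commute)
    show "pairing E Y (vec C) \<in> N" by (rule admissibleD(4) [OF adm C(1)])
  qed (use Y k C CD in auto)
  moreover have "w = k * D g"
  proof (rule proportional_entry [OF finite_E W(3)])
    show "pairing E (vec D) (vec C') \<in> N"
      using orthogonal [OF C'(1) D(1)] by (simp add: pairing_commute)
    show "pairing E Y (vec C') \<in> N" by (rule admissibleD(4) [OF adm C'(1)])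
  qed (use Y k C' CD in auto)
  ultimately show ?thesis
    by (intro null_of_proportional_cocircuit [OF adm D(1,3) k(1)]) (use W Y k in auto)
qed

text \<open>Either two of the positions form the trace of a circuit, which is the parallel case, or
  all three do. Then cocircuits avoiding \<open>e\<close> and avoiding \<open>f\<close> fix the
  ratios of the entries of \<open>X\<close>, which is proportional to that circuit.\<close>

lemma null_of_three:
  assumes adm: "admissible X Y" and W: "msupp E X \<inter> msupp E Y = {e, f, g}"
    "e \<noteq> f" "e \<noteq> g" "f \<noteq> g"
    and no_loop: "\<And>C h. C \<in> CC \<Longrightarrow> h \<in> {e, f, g} \<Longrightarrow> supp E C \<inter> msupp E Y \<noteq> {h}"
    and single: "\<And>h. h \<in> {e, f, g} \<Longrightarrow> \<exists>x. X h = {#x#}" "\<And>h. h \<in> {e, f, g} \<Longrightarrow> \<exists>y. Y h = {#y#}"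
  shows "pairing E X Y \<in> N"
proof -
  have in_supp: "e \<in> msupp E Y" "f \<in> msupp E Y" "g \<in> msupp E Y" "g \<in> E" using W by (auto simp: msupp_def)
  have no_coloop: False if "D \<in> DD" "supp E D \<subseteq> msupp E Y" "supp E D \<inter> msupp E X = {h}" for D h
    using coloop_entry_null [OF adm that] single(1) [of h] that W by force
  show ?thesis
  proof (cases "\<exists>C\<in>CC. supp E C \<inter> msupp E Y \<in> {{e, f}, {e, g}, {f, g}}")
    case True
    then obtain C where "C \<in> CC" and
      "supp E C \<inter> msupp E Y = {e, f} \<or> supp E C \<inter> msupp E Y = {e, g} \<or> supp E C \<inter> msupp E Y = {f, g}"
      by blast
    then consider "supp E C \<inter> msupp E Y = {e, f}" | "supp E C \<inter> msupp E Y = {e, g}"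
      | "supp E C \<inter> msupp E Y = {f, g}" by blast
    then show ?thesis
    proof cases
      case 1
      show ?thesis by (rule null_of_three_parallel [OF adm W _ _ _ \<open>C \<in> CC\<close> 1])
        (use no_loop single in auto)
    next
      case 2
      show ?thesis by (rule null_of_three_parallel [OF adm _ _ _ _ _ _ _ \<open>C \<in> CC\<close> 2, of f])
        (use W no_loop single in auto)
    next
      case 3
      show ?thesis by (rule null_of_three_parallel [OF adm _ _ _ _ _ _ _ \<open>C \<in> CC\<close> 3, of e])
        (use W no_loop single in auto)
    qed
  next
    case False
    obtain D where D: "D \<in> DD" "f \<in> supp E D" "supp E D \<subseteq> msupp E Y - {e}"
      using pair_dichotomy [of e Y f] in_supp W no_loop False by blast
    have "\<not> supp E D \<inter> msupp E X = {f}" using no_coloop [OF D(1), of f] D(3) by blast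
    then have D1: "supp E D \<inter> msupp E X = {f, g}" using W D by blast
    have "\<not> (\<exists>C\<in>CC. supp E C \<inter> msupp E Y = {f, e})" using False by (auto simp: insert_commute)
    then obtain D' where D': "D' \<in> DD" "e \<in> supp E D'" "supp E D' \<subseteq> msupp E Y - {f}"
      using pair_dichotomy [of f Y e] in_supp W no_loop by blast
    have "\<not> supp E D' \<inter> msupp E X = {e}" using no_coloop [OF D'(1), of e] D'(3) by blast
    then have D2: "supp E D' \<inter> msupp E X = {e, g}" using W D' by blast
    have "msupp E Y - {e, f} \<subseteq> E" "g \<in> msupp E Y - {e, f}" using in_supp W by (auto simp: msupp_def)
    from dichotomy [OF this] obtain C where C: "C \<in> CC" "supp E C \<inter> (msupp E Y - {e, f}) = {g}"
    proof
      assume "\<exists>D\<in>DD. g \<in> supp E D \<and> supp E D \<subseteq> msupp E Y - {e, f}"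
      then obtain D where D: "D \<in> DD" "g \<in> supp E D" "supp E D \<subseteq> msupp E Y - {e, f}" by blast
      then have "supp E D \<inter> msupp E X = {g}" using W by blast
      then show thesis using no_coloop D by blast
    qed blast
    have CS: "supp E C \<inter> msupp E Y = {e, f, g}"
    proof -
      have "supp E C \<inter> msupp E Y \<noteq> {g}" using no_loop C by blast
      moreover have "supp E C \<inter> msupp E Y \<noteq> {e, g}" "supp E C \<inter> msupp E Y \<noteq> {f, g}" using False C by auto
      ultimately show ?thesis using C by blast
    qed
    have "supp E C \<inter> supp E D = supp E D \<inter> {e, f, g}" using CS D(3) by blast
    moreover have "supp E C \<inter> supp E D' = supp E D' \<inter> {e, f, g}" using CS D'(3) by blast
    moreover have "g \<in> supp E D" "e \<notin> supp E D" "g \<in> supp E D'" "f \<notin> supp E D'"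
      using D1 D2 D(3) D'(3) by blast+
    ultimately have C1: "supp E C \<inter> supp E D = {g, f}" and C2: "supp E C \<inter> supp E D' = {g, e}"
      using D(2) D'(2) by (simp_all add: insert_commute)
    obtain x z w where X: "X e = {#x#}" "X f = {#z#}" "X g = {#w#}"
      using single(1) [of e] single(1) [of f] single(1) [of g] by auto
    have "w \<noteq> 0" using admissibleD(1) [OF adm in_supp(4)] X by simp
    moreover have "C g \<noteq> 0" using C by (auto simp: supp_def)
    ultimately obtain k where k: "k \<noteq> 0" "w = k * C g" using unit_multiple by blast
    have "z = k * C f"
    proof (rule proportional_entry [OF finite_E])
      show "pairing E (vec C) (vec D) \<in> N" using orthogonal [OF C(1) D(1)] .
      show "pairing E X (vec D) \<in> N" using admissibleD(3) [OF adm D(1)] D by blast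
      show "msupp E X \<inter> supp E D = {g, f}" using D1 by blast
    qed (use X k W C1 in auto)
    moreover have "x = k * C e"
    proof (rule proportional_entry [OF finite_E])
      show "pairing E (vec C) (vec D') \<in> N" using orthogonal [OF C(1) D'(1)] .
      show "pairing E X (vec D') \<in> N" using admissibleD(3) [OF adm D'(1)] D' by blast
      show "msupp E X \<inter> supp E D' = {g, e}" using D2 by blast
    qed (use X k W C2 in auto)
    ultimately show ?thesis
      by (intro null_of_proportional_circuit [OF adm C(1) _ k(1)]) (use W X k CS in auto)
  qed
qed

section \<open>Elimination of an entry of \<open>Y\<close> along a cocircuit\<close>

text \<open>The induction hypothesis applies to the vector \<open>Y'\<close> with \<open>e\<close>
  eliminated. To return to \<open>Y\<close>, the non-null remainder of
  \<open>pairing E X (vec D)\<close> without \<open>x\<close> is traded for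
  \<open>x\<close>.\<close>

lemma reduction:
  assumes adm: "admissible X Y" and D: "D \<in> DD" "supp E D \<subseteq> msupp E Y"
    and e: "e \<in> supp E D" and Xe: "X e = add_mset x X'"
    and not_null: "pairing E (X(e := X')) (vec D) \<notin> N"
    and large: "size (pairing E X Y) \<ge> 4"
    and IH: "\<And>Y'. admissible X Y' \<Longrightarrow> card (msupp E Y') < card (msupp E Y) \<Longrightarrow> pairing E X Y' \<in> N"
  shows "pairing E X Y \<in> N"
proof -
  have eE: "e \<in> E" and De: "D e \<noteq> 0" using e by (auto simp: supp_def)
  have Ye: "Y e \<noteq> {#}" using e D by (auto simp: msupp_def)
  have zeros: "0 \<notin># X'" "x \<noteq> 0" using admissibleD(1) [OF adm eE] Xe by auto
  obtain b where b: "b \<noteq> 0" "b * D e = 1" using De unit_inverse by metis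
  define c where "c = \<epsilon> * b"
  have c: "c \<noteq> 0" "c * D e = \<epsilon>" using b by (simp_all add: c_def mult.assoc)
  define F where "F = E - {e}"
  have F: "finite F" using finite_E by (simp add: F_def)
  \<comment> \<open>As \<open>c\<close> is minus the inverse of \<open>D e\<close>, the entry at
    \<open>e\<close> would be \<open>Y e + neg (Y e)\<close>; setting it to zero is what shrinks the
    support.\<close>
  define Y' where "Y' = (\<lambda>g. if g = e then {#} else Y g + gsr_act c (gsr_mult (vec D g) (Y e)))"
  have pairing_Y': "pairing E Z Y' = pairing F Z Y + gsr_act c (gsr_mult (pairing F Z (vec D)) (Y e))" for Z
  proof -
    have "pairing E Z Y' = pairing F Z Y'"
      by (rule pairing_subset) (auto simp: finite_E F_def Y'_def)
    also have "\<dots> = (\<Sum>g\<in>F. gsr_mult (Z g) (Y g) + gsr_act c (gsr_mult (gsr_mult (Z g) (vec D g)) (Y e)))"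
      unfolding pairing_def by (rule sum.cong) (auto simp: Y'_def F_def gsr_mult_act_right gsr_mult_assoc)
    also have "\<dots> = pairing F Z Y + gsr_act c (gsr_mult (pairing F Z (vec D)) (Y e))"
      by (simp add: pairing_def sum.distrib gsr_act_sum gsr_mult_sum_left F)
    finally show ?thesis .
  qed
  have supp_Y': "msupp E Y' \<subseteq> msupp E Y - {e}"
    using D by (auto simp: msupp_def Y'_def supp_def)
  moreover have "e \<in> msupp E Y" using e D by blast
  ultimately have smaller: "card (msupp E Y') < card (msupp E Y)"
    by (intro psubset_card_mono) (auto simp: msupp_def finite_E)
  have circuits: "pairing E Y' (vec C) \<in> N" if C: "C \<in> CC" for C
  proof -
    define \<alpha> where "\<alpha> = pairing F (vec C) Y"
    define \<delta> where "\<delta> = gsr_act c (pairing F (vec C) (vec D))"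
    \<comment> \<open>With \<open>vec C e\<close> in place of \<open>\<delta>\<close> this is the
      null sum \<open>pairing E Y (vec C)\<close>.\<close>
    have eq: "pairing E Y' (vec C) = \<alpha> + gsr_mult \<delta> (Y e)"
      by (subst pairing_commute) (simp add: pairing_Y' \<alpha>_def \<delta>_def gsr_mult_act_left)
    have "pairing E (vec C) Y \<in> N"
      using admissibleD(4) [OF adm C] by (subst pairing_commute)
    then have CY: "gsr_mult (vec C e) (Y e) + \<alpha> \<in> N"
      by (simp add: pairing_remove [OF finite_E eE] \<alpha>_def F_def)
    have "gsr_mult (vec C e) (vec D e) + pairing F (vec C) (vec D) \<in> N"
      using orthogonal [OF C D(1)] by (simp add: pairing_remove [OF finite_E eE] F_def)
    from T3 [OF c(1) this] have CD: "gsr_act c (gsr_mult (vec C e) (vec D e)) + \<delta> \<in> N"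
      by (simp add: \<delta>_def)
    show ?thesis
    proof (cases "C e = 0")
      case True
      then have "\<alpha> \<in> N" "\<delta> \<in> N" using CY CD by simp_all
      then show ?thesis unfolding eq using admissibleD(2) [OF adm eE]
        by (intro null_add null_mult_left)
    next
      case Ce: False
      have "c * (D e * C e) = \<epsilon> * C e" using c(2) by (simp add: mult.assoc [symmetric])
      then have CD': "\<delta> + neg {#C e#} \<in> N" using CD Ce De by (simp add: gsr_of_nonzero)
      have CY': "\<alpha> + gsr_mult {#C e#} (Y e) \<in> N" using CY Ce by (simp add: gsr_of_nonzero add.commute)
      \<comment> \<open>Where \<open>C\<close> and \<open>D\<close> meet, \<open>Y\<close> is
        nonzero as well. The bound five of \<open>swap_factor\<close> follows once
        \<open>\<delta>\<close> has two terms; a single term must be \<open>C e\<close>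
        itself.\<close>
      have sizes: "size \<delta> \<le> size \<alpha>"
      proof -
        have "size (gsr_mult (vec C g) (vec D g)) \<le> size (gsr_mult (vec C g) (Y g))" if "g \<in> F" for g
        proof (cases "D g = 0")
          case False
          then have "g \<in> supp E D" using that by (auto simp: supp_def F_def)
          then have "Y g \<noteq> {#}" using D by (auto simp: msupp_def)
          then have "size (vec D g) \<le> size (Y g)" using False
            by (simp add: gsr_of_nonzero Suc_le_eq nonempty_has_size)
          then show ?thesis by simp
        qed simp
        then have "(\<Sum>g\<in>F. size (gsr_mult (vec C g) (vec D g))) \<le> (\<Sum>g\<in>F. size (gsr_mult (vec C g) (Y g)))"
          by (rule sum_mono)
        then show ?thesis by (simp add: \<alpha>_def \<delta>_def pairing_def)
      qed
      have "\<delta> \<noteq> {#}" using CD' by auto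
      then have "size \<delta> \<ge> 1" by (simp add: Suc_le_eq nonempty_has_size)
      then consider "size \<delta> = 1" | "size \<delta> \<ge> 2" by linarith
      then show ?thesis
      proof cases
        case 1
        then obtain d where "\<delta> = {#d#}" using size_1_singleton_mset by blast
        then have "\<delta> = {#C e#}" using CD' by (simp add: pair_null_iff)
        then show ?thesis using eq CY' by simp
      next
        case 2
        show ?thesis unfolding eq
        proof (rule swap_factor [OF CY' _ CD'])
          show "0 \<notin># Y e" using admissibleD(2) [OF adm eE] .
          have "size (Y e) \<ge> 1" using Ye by (simp add: Suc_le_eq nonempty_has_size)
          then show "5 \<le> size \<alpha> + size \<delta> + size (Y e)" using 2 sizes by linarith
        qed simp
      qed
    qed
  qed
  have "admissible X Y'"
    unfolding admissible_def
  proof (intro conjI ballI impI)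
    fix g assume g: "g \<in> E"
    show "0 \<notin># X g" by (rule admissibleD(1) [OF adm g])
    have "0 \<notin># gsr_act c (gsr_mult (vec D g) (Y e))"
      using c(1) admissibleD(2) [OF adm eE]
      by (cases "D g = 0") (auto simp: gsr_of_nonzero gsr_act_def)
    then show "0 \<notin># Y' g" using admissibleD(2) [OF adm g] by (auto simp: Y'_def)
  next
    fix D' assume "D' \<in> DD" "supp E D' \<subseteq> msupp E Y'"
    then show "pairing E X (vec D') \<in> N" using supp_Y' by (intro admissibleD(3) [OF adm]) auto
  qed (rule circuits)
  then have "pairing E X Y' \<in> N" using smaller by (rule IH)
  then have XY': "pairing F X Y + gsr_act c (gsr_mult (pairing F X (vec D)) (Y e)) \<in> N"
    by (simp add: pairing_Y')
  define R where "R = pairing E (X(e := X')) (vec D)"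
  have R: "R = gsr_act (D e) X' + pairing F X (vec D)"
    using De by (simp add: R_def pairing_upd [OF finite_E eE] F_def gsr_of_nonzero)
  \<comment> \<open>Scaling by \<open>c\<close> turns the deleted term \<open>D e * x\<close> into
    \<open>\<epsilon> * x\<close>. Hence \<open>{#x#} + neg \<gamma>\<close> is null, and
    \<open>\<gamma>\<close> can be traded for \<open>x\<close>.\<close>
  define \<gamma> where "\<gamma> = gsr_act c R"
  have "\<gamma> \<notin> N" using not_null act_null_iff c(1) by (simp add: \<gamma>_def R_def)
  have "pairing E X (vec D) = add_mset (D e * x) R"
    using Xe De by (simp add: R pairing_remove [OF finite_E eE] F_def gsr_of_nonzero)
  then have "add_mset (D e * x) R \<in> N" using admissibleD(3) [OF adm D] by simp
  from T3 [OF c(1) this] have "add_mset (c * (D e * x)) \<gamma> \<in> N" by (simp add: \<gamma>_def)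
  then have "add_mset (\<epsilon> * x) \<gamma> \<in> N" using c(2) by (simp add: mult.assoc [symmetric])
  from neg_null [OF this] have x\<gamma>: "{#x#} + neg \<gamma> \<in> N" by simp
  define A where "A = pairing F X Y + gsr_mult X' (Y e)"
  have XY: "pairing E X Y = A + gsr_mult {#x#} (Y e)"
    using Xe by (simp add: A_def pairing_remove [OF finite_E eE] F_def ac_simps)
  \<comment> \<open>This supplies the product of \<open>X'\<close> and \<open>Y e\<close>, which
    belongs to \<open>A\<close>, together with its negative, which belongs to the product of
    \<open>\<gamma>\<close> and \<open>Y e\<close>.\<close>
  have "gsr_mult X' (Y e + neg (Y e)) \<in> N"
    using zeros admissibleD(2) [OF adm eE] by (intro null_mult_right self_neg_null)
  from null_add [OF XY' this] have A\<gamma>: "A + gsr_mult \<gamma> (Y e) \<in> N"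
    using c(2) by (simp add: A_def \<gamma>_def R gsr_mult_act_left gsr_mult_act_right ac_simps)
  show ?thesis unfolding XY
  proof (rule swap_factor [OF A\<gamma> \<open>\<gamma> \<notin> N\<close> x\<gamma>])
    show "0 \<notin># Y e" using admissibleD(2) [OF adm eE] .
    show "5 \<le> size A + size {#x#} + size (Y e)" using large XY by simp
  qed
qed

section \<open>Deletion of summands of \<open>X\<close>, and the double induction\<close>

lemma pairing_remove_one:
  assumes "e \<in> E" "X e = add_mset x X'"
  shows "pairing E X Y = gsr_act x (Y e) + pairing E (X(e := X')) Y"
  unfolding pairing_upd [OF finite_E assms(1)] pairing_remove [OF finite_E assms(1), of X]
  by (simp add: assms ac_simps)

lemma pairing_elem:
  assumes "p \<in># pairing E X Y"
  obtains e x X' y where "e \<in> E" "X e = add_mset x X'" "y \<in># Y e" "p = x * y"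
proof -
  have "\<exists>e\<in>A. p \<in># f e" if "finite A" "p \<in># sum f A" for A :: "'e set" and f
    using that by (induction A rule: finite_induct) auto
  then have "\<exists>e\<in>E. p \<in># gsr_mult (X e) (Y e)"
    using assms finite_E unfolding pairing_def by blast
  then obtain e where e: "e \<in> E" "p \<in># gsr_mult (X e) (Y e)" by blast
  have "\<exists>x\<in>#\<alpha>. \<exists>y\<in>#\<beta>. p = x * y" if "p \<in># gsr_mult \<alpha> \<beta>" for \<alpha> \<beta>
    using that by (induction \<alpha>) (auto simp: gsr_act_def)
  with e(2) obtain x y where "x \<in># X e" "y \<in># Y e" "p = x * y" by blast
  then show thesis using that e by (metis mset_add)
qed

text \<open>Every common position contributes at least one term, so there are two or three of them;
  three leave room only for single units.\<close>

lemma null_of_small: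
  assumes adm: "admissible X Y" and small: "size (pairing E X Y) \<le> 3"
    and no_loop: "\<And>C e. C \<in> CC \<Longrightarrow> e \<in> msupp E X \<inter> msupp E Y \<Longrightarrow> supp E C \<inter> msupp E Y \<noteq> {e}"
    and card: "card (msupp E X \<inter> msupp E Y) \<ge> 2"
  shows "pairing E X Y \<in> N"
proof -
  define W where "W = msupp E X \<inter> msupp E Y"
  have W: "finite W" "W \<subseteq> E" using finite_E by (auto simp: W_def msupp_def)
  have "pairing E X Y = pairing W X Y"
    by (rule pairing_subset) (auto simp: finite_E W_def msupp_def)
  then have total: "(\<Sum>e\<in>W. size (X e) * size (Y e)) \<le> 3" using small by (simp add: pairing_def)
  have pos: "size (X e) * size (Y e) \<ge> 1" if "e \<in> W" for e
    using that by (simp add: W_def msupp_def Suc_le_eq nonempty_has_size)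
  have "card W = (\<Sum>e\<in>W. 1)" by simp
  also have "\<dots> \<le> (\<Sum>e\<in>W. size (X e) * size (Y e))" by (rule sum_mono) (rule pos)
  finally have "card W \<le> 3" using total by linarith
  then consider "card W = 2" | "card W = 3" using card unfolding W_def by linarith
  then show ?thesis
  proof cases
    case 1
    then obtain e f where "W = {e, f}" "e \<noteq> f" by (meson card_2_iff)
    then show ?thesis using null_of_two [OF adm, of e f] no_loop small by (simp add: W_def)
  next
    case 2
    then obtain e f g where efg: "W = {e, f, g}" "e \<noteq> f" "e \<noteq> g" "f \<noteq> g" by (metis card_3_iff)
    define a where "a h = size (X h) * size (Y h)" for h
    have "a e + a f + a g \<le> 3" using total efg by (simp add: a_def)
    moreover have "a e \<ge> 1" "a f \<ge> 1" "a g \<ge> 1" using pos efg(1) by (simp_all add: a_def)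
    ultimately have "a e = 1" "a f = 1" "a g = 1" by linarith+
    then have a: "a h = 1" if "h \<in> {e, f, g}" for h using that by blast
    have single: "\<exists>x. X h = {#x#}" "\<exists>y. Y h = {#y#}" if "h \<in> {e, f, g}" for h
    proof -
      have "size (X h) = 1" "size (Y h) = 1" using a [OF that] by (simp_all add: a_def)
      then show "\<exists>x. X h = {#x#}" "\<exists>y. Y h = {#y#}" using size_1_singleton_mset by blast+
    qed
    show ?thesis
    proof (rule null_of_three [OF adm _ efg(2-4)])
      show "msupp E X \<inter> msupp E Y = {e, f, g}" using efg(1) by (simp add: W_def)
      then show "supp E C \<inter> msupp E Y \<noteq> {h}" if "C \<in> CC" "h \<in> {e, f, g}" for C h
        using no_loop [OF that(1), of h] that(2) by simp
    qed (rule single, assumption)+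
  qed
qed

text \<open>Deleting a summand of \<open>X\<close> preserves admissibility, so induction yields a
  null sum; the deleted terms are restored by absorption into a maximal term.\<close>

lemma null_of_irreducible:
  assumes adm: "admissible X Y" and large: "size (pairing E X Y) \<ge> 4"
    and card: "card (msupp E X \<inter> msupp E Y) \<ge> 2"
    and cocircuit: "\<And>e. e \<in> msupp E X \<inter> msupp E Y \<Longrightarrow> \<exists>D\<in>DD. e \<in> supp E D \<and> supp E D \<subseteq> msupp E Y"
    and irreducible: "\<And>e x X' D. D \<in> DD \<Longrightarrow> supp E D \<subseteq> msupp E Y \<Longrightarrow> e \<in> supp E D \<Longrightarrow>
      X e = add_mset x X' \<Longrightarrow> pairing E (X(e := X')) (vec D) \<in> N"
    and IH: "\<And>e x X'. e \<in> E \<Longrightarrow> X e = add_mset x X' \<Longrightarrow> admissible (X(e := X')) Y \<Longrightarrow>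
      pairing E (X(e := X')) Y \<in> N"
  shows "pairing E X Y \<in> N"
proof -
  have "msupp E X \<inter> msupp E Y \<noteq> {}" using card by auto
  then obtain e D where e: "e \<in> msupp E X" and D: "D \<in> DD" "e \<in> supp E D" "supp E D \<subseteq> msupp E Y"
    using cocircuit by blast
  \<comment> \<open>The one-term deletions of \<open>pairing E X (vec D)\<close> are exactly the
    deletions of one summand of \<open>X\<close> at a position in the support of
    \<open>D\<close>.\<close>
  have "below 1 1"
  proof (rule below_refl_of_removable)
    show "pairing E X (vec D) \<in> N" by (rule admissibleD(3) [OF adm D(1,3)])
    have "gsr_mult (X e) (vec D e) \<noteq> {#}"
      using e D by (simp add: msupp_def supp_def gsr_of_nonzero flip: size_eq_0_iff_empty)
    then show "pairing E X (vec D) \<noteq> {#}"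
      using e by (simp add: pairing_remove [OF finite_E, of e] msupp_def)
  next
    fix p assume "p \<in># pairing E X (vec D)"
    then obtain g x X' y where g: "g \<in> E" "X g = add_mset x X'" "y \<in># vec D g" "p = x * y"
      by (rule pairing_elem)
    then have Dg: "D g \<noteq> 0" and "y = D g" by (auto simp: gsr_of_def split: if_splits)
    then have "pairing E X (vec D) = add_mset p (pairing E (X(g := X')) (vec D))"
      using g by (simp add: pairing_remove_one gsr_of_nonzero)
    moreover have "pairing E (X(g := X')) (vec D) \<in> N"
      by (rule irreducible [OF D(1,3) _ g(2)]) (use g Dg in \<open>simp add: supp_def\<close>)
    ultimately show "pairing E X (vec D) - {#p#} \<in> N" by simp
  qed
  then interpret reflexive_msf_tract N by unfold_locales
  have nz: "0 \<notin># pairing E X Y"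
  proof
    assume "0 \<in># pairing E X Y"
    then obtain g x X' y where "g \<in> E" "X g = add_mset x X'" "y \<in># Y g" "0 = x * y"
      by (rule pairing_elem)
    then show False using admissibleD(1,2) [OF adm, of g] by auto
  qed
  moreover have "pairing E X Y \<noteq> {#}" using large by auto
  ultimately obtain p where p: "p \<in># pairing E X Y" and max: "\<And>q. q \<in># pairing E X Y \<Longrightarrow> below q p"
    using ex_below_max by blast
  obtain g x X' y where g: "g \<in> E" "X g = add_mset x X'" "y \<in># Y g" "p = x * y"
    using p by (rule pairing_elem)
  \<comment> \<open>A second position \<open>f\<close> is wanted so that deleting there keeps the
    maximal term \<open>p\<close>.\<close>
  have "\<not> msupp E X \<inter> msupp E Y \<subseteq> {g}"
    using card card_mono [of "{g}" "msupp E X \<inter> msupp E Y"] by auto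
  then obtain f where f: "f \<in> msupp E X" "f \<in> msupp E Y" "f \<noteq> g" by blast
  then have fE: "f \<in> E" by (simp add: msupp_def)
  obtain z Z where Z: "X f = add_mset z Z" using f by (metis (mono_tags, lifting) mem_Collect_eq msupp_def multiset_cases)
  have XY: "pairing E X Y = pairing E (X(f := Z)) Y + gsr_act z (Y f)"
    by (simp add: pairing_remove_one [where X = X, OF fE Z] add.commute)
  \<comment> \<open>Cocircuits through \<open>f\<close> are covered by \<open>irreducible\<close>;
    the others do not see the deletion.\<close>
  have "admissible (X(f := Z)) Y"
    unfolding admissible_def
  proof (intro conjI ballI impI)
    fix h assume "h \<in> E"
    then show "0 \<notin># (X(f := Z)) h" "0 \<notin># Y h" using admissibleD(1,2) [OF adm, of h] Z by auto
  next
    fix D assume D: "D \<in> DD" "supp E D \<subseteq> msupp E Y"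
    show "pairing E (X(f := Z)) (vec D) \<in> N"
    proof (cases "f \<in> supp E D")
      case True
      then show ?thesis using irreducible D Z by blast
    next
      case False
      then have "D f = 0" using fE by (simp add: supp_def)
      then show ?thesis using admissibleD(3) [OF adm D] by (simp add: pairing_remove_one [where X = X, OF fE Z])
    qed
  qed (rule admissibleD(4) [OF adm])
  then have "pairing E (X(f := Z)) Y \<in> N" by (rule IH [OF fE Z])
  moreover have "p \<in># pairing E (X(f := Z)) Y"
  proof -
    have "(X(f := Z)) g = add_mset x X'" using f g by simp
    from pairing_remove_one [where X = "X(f := Z)", OF g(1) this, of Y] show ?thesis using g by (simp add: gsr_act_def)
  qed
  ultimately show ?thesis
    unfolding XY by (rule null_add_dominated) (use large max XY in auto)
qed

lemma sum_size_upd_less: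
  assumes "e \<in> E" "size \<alpha> < size (X e)"
  shows "(\<Sum>g\<in>E. size ((X(e := \<alpha>)) g)) < (\<Sum>g\<in>E. size (X g))"
  by (rule sum_strict_mono_ex1) (use assms finite_E in auto)

text \<open>Elimination keeps \<open>X\<close> and shrinks the support of \<open>Y\<close>, though
  its entries may grow; deletion keeps \<open>Y\<close> and shortens \<open>X\<close>. Hence the
  nested inductions.\<close>

theorem pairing_null:
  assumes "admissible X Y"
  shows "pairing E X Y \<in> N"
  using assms
proof (induction "card (msupp E Y)" arbitrary: X Y rule: less_induct)
  case outer: less
  show ?case
    using outer.prems
  proof (induction "\<Sum>e\<in>E. size (X e)" arbitrary: X rule: less_induct)
    case inner: less
    note adm = inner.prems
    show ?case
    proof (cases "\<exists>C\<in>CC. \<exists>e\<in>msupp E X \<inter> msupp E Y. supp E C \<inter> msupp E Y = {e}")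
      case True
      then obtain C e where C: "C \<in> CC" "supp E C \<inter> msupp E Y = {e}"
        and e: "e \<in> msupp E X" "e \<in> msupp E Y" by blast
      then have eE: "e \<in> E" by (simp add: msupp_def)
      \<comment> \<open>A cocircuit inside \<open>msupp E Y\<close> through \<open>e\<close> would
        meet \<open>C\<close> in \<open>e\<close> alone, so all of \<open>X e\<close> can be
        deleted.\<close>
      have "admissible (X(e := {#})) Y"
        unfolding admissible_def
      proof (intro conjI ballI impI)
        fix h assume "h \<in> E"
        then show "0 \<notin># (X(e := {#})) h" "0 \<notin># Y h" using admissibleD(1,2) [OF adm, of h] by auto
      next
        fix D assume D: "D \<in> DD" "supp E D \<subseteq> msupp E Y"
        then have "e \<notin> supp E D" using circuit_cocircuit_not_single [OF C(1) D(1), of e] C D by blast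
        then have "D e = 0" using eE by (simp add: supp_def)
        then show "pairing E (X(e := {#})) (vec D) \<in> N"
          using admissibleD(3) [OF adm D] eE by (simp add: pairing_upd pairing_remove [of E e] finite_E)
      qed (rule admissibleD(4) [OF adm])
      then have "pairing E (X(e := {#})) Y \<in> N"
        by (intro inner.hyps sum_size_upd_less eE)
          (use e in \<open>simp_all add: msupp_def flip: nonempty_has_size\<close>)
      moreover have "gsr_mult (X e) (Y e) \<in> N"
        using admissibleD(1) [OF adm eE] loop_entry_null [OF adm C] by (intro null_mult_right)
      ultimately have "pairing E (X(e := {#})) Y + gsr_mult (X e) (Y e) \<in> N" by (rule null_add)
      then show ?thesis using eE by (simp add: pairing_upd pairing_remove [of E e] finite_E add.commute)
    next
      case no_loop: False
      have cocircuit: "\<exists>D\<in>DD. e \<in> supp E D \<and> supp E D \<subseteq> msupp E Y"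
        if "e \<in> msupp E X \<inter> msupp E Y" for e
        using dichotomy [of "msupp E Y" e] no_loop that by (auto simp: msupp_def)
      show ?thesis
      proof (cases "card (msupp E X \<inter> msupp E Y) \<ge> 2")
        case False
        have fin: "finite (msupp E X \<inter> msupp E Y)" using finite_E by (simp add: msupp_def)
        \<comment> \<open>A cocircuit through the only common position meets \<open>X\<close>
          nowhere else, so that entry of \<open>X\<close> is null.\<close>
        have "gsr_mult (X e) (Y e) \<in> N" if "e \<in> E" for e
        proof (cases "e \<in> msupp E X \<inter> msupp E Y")
          case True
          then have "card (msupp E X \<inter> msupp E Y) = 1"
            using False fin by (metis One_nat_def Suc_1 card_0_eq empty_iff less_2_cases not_le)
          then have "msupp E X \<inter> msupp E Y = {e}" using True by (metis card_1_singletonE singletonD)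
          moreover obtain D where D: "D \<in> DD" "e \<in> supp E D" "supp E D \<subseteq> msupp E Y"
            using cocircuit True by blast
          ultimately have "supp E D \<inter> msupp E X = {e}" by blast
          then have "X e \<in> N" by (rule coloop_entry_null [OF adm D(1,3)])
          then show ?thesis using admissibleD(2) [OF adm that] by (rule null_mult_left)
        next
          case False
          then show ?thesis using that by (auto simp: msupp_def)
        qed
        then show ?thesis unfolding pairing_def by (intro null_sum finite_E)
      next
        case card: True
        show ?thesis
        proof (cases "size (pairing E X Y) \<le> 3")
          case True
          then show ?thesis using no_loop by (intro null_of_small [OF adm True _ card]) blast
        next
          case False
          then have large: "size (pairing E X Y) \<ge> 4" by simp
          show ?thesis
          proof (rule ccontr)
            \<comment> \<open>This makes \<open>irreducible\<close> available: a deletion violating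
              it would let \<open>reduction\<close> prove the goal.\<close>
            assume not_null: "pairing E X Y \<notin> N"
            have "pairing E X Y \<in> N"
            proof (rule null_of_irreducible [OF adm large card cocircuit])
              fix e x X' D
              assume "D \<in> DD" "supp E D \<subseteq> msupp E Y" "e \<in> supp E D" "X e = add_mset x X'"
              then show "pairing E (X(e := X')) (vec D) \<in> N"
                using reduction [OF adm _ _ _ _ _ large] outer.hyps not_null by blast
            next
              fix e x X'
              assume "e \<in> E" "X e = add_mset x X'" "admissible (X(e := X')) Y"
              then show "pairing E (X(e := X')) Y \<in> N"
                by (intro inner.hyps sum_size_upd_less) simp_all
            qed
            then show False using not_null by contradiction
          qed
        qed
      qed
    qed
  qed
qed

end


section \<open>Circuits and cocircuits of a matroid\<close>

context matroid
begin

lemma finite_indep: "X \<in> I \<Longrightarrow> finite X"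
  using finite_ground finite_subset indep_subset by blast

text \<open>A minimal dependent subset of \<open>Q\<close> contains \<open>e\<close>, as
  \<open>Q - {e}\<close> is independent. A general down-closed \<open>J\<close> covers both
  \<open>I\<close> and \<open>dual_indep E I\<close>.\<close>

lemma circuit_in_dependent:
  assumes "Q \<subseteq> E" "Q \<notin> J" "\<And>X Y. X \<in> J \<Longrightarrow> Y \<subseteq> X \<Longrightarrow> Y \<in> J" "Q - {e} \<in> J"
  obtains K where "K \<in> matroid_circuits E J" "K \<subseteq> Q" "e \<in> K"
proof -
  have "finite Q" using assms(1) finite_ground finite_subset by blast
  then obtain K where K: "K \<subseteq> Q" "K \<notin> J" and min: "\<And>X. X \<subseteq> K \<Longrightarrow> X \<notin> J \<Longrightarrow> X = K"
    using finite_has_minimal2 [of "{K. K \<subseteq> Q \<and> K \<notin> J}" Q] assms(2)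
    by (auto simp: finite_Pow_iff [unfolded Pow_def]) (metis (no_types, lifting) order_trans)
  have "K \<in> matroid_circuits E J"
    using K assms(1) min by (auto simp: matroid_circuits_def)
  moreover have "e \<in> K" using K assms(3) [OF assms(4), of K] by blast
  ultimately show thesis using K that by blast
qed

lemma bases_card_eq:
  assumes "B \<in> matroid_bases I" "B' \<in> matroid_bases I"
  shows "card B = card B'"
proof -
  have "\<not> card B < card B'" if "B \<in> matroid_bases I" "B' \<in> matroid_bases I" for B B'
    using augment [of B B'] that by (auto simp: matroid_bases_def)
  then show ?thesis using assms by (meson linorder_neqE_nat)
qed

lemma extend_to_maximal:
  assumes "X \<in> I" "X \<subseteq> Z"
  obtains B where "X \<subseteq> B" "B \<subseteq> Z" "B \<in> I" "\<And>Y. Y \<in> I \<Longrightarrow> Y \<subseteq> Z \<Longrightarrow> B \<subseteq> Y \<Longrightarrow> Y = B"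
proof -
  have "finite {Y \<in> I. X \<subseteq> Y \<and> Y \<subseteq> Z}"
    by (rule finite_subset [of _ "Pow E"]) (use finite_ground indep_subset in auto)
  then show thesis
    using finite_has_maximal2 [of "{Y \<in> I. X \<subseteq> Y \<and> Y \<subseteq> Z}" X] assms that
    by (smt (verit, best) mem_Collect_eq order_refl order_trans)
qed

lemma dual_indep_mono: "X \<in> dual_indep E I \<Longrightarrow> Y \<subseteq> X \<Longrightarrow> Y \<in> dual_indep E I"
  by (auto simp: dual_indep_def)

text \<open>The first case is that \<open>e\<close> lies in the closure of \<open>E - S\<close>.\<close>

lemma circuit_cocircuit_dichotomy:
  assumes S: "S \<subseteq> E" "e \<in> S"
  shows "(\<exists>K\<in>matroid_circuits E I. K \<inter> S = {e}) \<or>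
    (\<exists>K\<in>matroid_circuits E (dual_indep E I). e \<in> K \<and> K \<subseteq> S)"
proof -
  obtain A where A: "A \<subseteq> E - S" "A \<in> I" and A_max: "\<And>Y. Y \<in> I \<Longrightarrow> Y \<subseteq> E - S \<Longrightarrow> A \<subseteq> Y \<Longrightarrow> Y = A"
    by (rule extend_to_maximal [of "{}" "E - S"]) (use indep_empty in auto)
  show ?thesis
  proof (cases "insert e A \<in> I")
    case False
    have "e \<notin> A" using A S by blast
    then have "insert e A - {e} \<in> I" using A by simp
    moreover have "insert e A \<subseteq> E" using A(1) S by blast
    ultimately obtain K where K: "K \<in> matroid_circuits E I" "K \<subseteq> insert e A" "e \<in> K"
      using circuit_in_dependent [of "insert e A" I e] False indep_mono by blast
    have "K \<inter> S = {e}" using K(2,3) A(1) S(2) by auto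
    then show ?thesis using K(1) by blast
  next
    case True
    then obtain B where B: "insert e A \<subseteq> B" "B \<subseteq> E" "B \<in> I"
      and B_max: "\<And>Y. Y \<in> I \<Longrightarrow> Y \<subseteq> E \<Longrightarrow> B \<subseteq> Y \<Longrightarrow> Y = B"
      using extend_to_maximal [OF True, of E] indep_subset by metis
    have basis: "B \<in> matroid_bases I"
      using B B_max indep_subset by (auto simp: matroid_bases_def)
    \<comment> \<open>This is \<open>S - B\<close> together with \<open>e\<close>. The basis
      \<open>B\<close> shows that \<open>S - B\<close> is coindependent. A basis avoiding
      \<open>Q\<close> would augment \<open>B - {e}\<close> by an element outside \<open>S\<close>,
      against the maximality of \<open>A\<close>.\<close>
    define Q where "Q = S - (B - {e})"
    have "Q \<notin> dual_indep E I"
    proof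
      assume "Q \<in> dual_indep E I"
      then obtain B' where B': "B' \<in> matroid_bases I" "Q \<subseteq> E - B'" by (auto simp: dual_indep_def)
      have "B - {e} \<in> I" by (rule indep_mono [OF B(3)]) auto
      moreover have "card (B - {e}) < card B'"
        using bases_card_eq [OF basis B'(1)] B finite_indep card_Diff1_less [of B e] by simp
      moreover have "B' \<in> I" using B' by (simp add: matroid_bases_def)
      ultimately obtain y where y: "y \<in> B'" "y \<notin> B - {e}" "insert y (B - {e}) \<in> I"
        using augment [of "B - {e}" B'] by blast
      have "y \<in> E - S" using y B' \<open>B' \<in> I\<close> indep_subset by (auto simp: Q_def)
      moreover have "insert y A \<in> I" using y(3) B(1) A S by (auto intro: indep_mono [OF y(3)])
      ultimately have "insert y A = A" using A by (intro A_max) auto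
      then show False using y B A S by blast
    qed
    moreover have "Q - {e} \<in> dual_indep E I"
      using basis S by (auto simp: dual_indep_def Q_def)
    moreover have "Q \<subseteq> E" using S by (auto simp: Q_def)
    ultimately obtain K where "K \<in> matroid_circuits E (dual_indep E I)" "K \<subseteq> Q" "e \<in> K"
      using circuit_in_dependent [of Q "dual_indep E I" e] dual_indep_mono by blast
    then show ?thesis by (auto simp: Q_def)
  qed
qed

end

section \<open>Signatures and the involution\<close>

lemma (in tract) supp_scale: "a \<noteq> 0 \<Longrightarrow> supp E (scale E a X) = supp E (X :: 'e \<Rightarrow> 'a)"
proof -
  assume "a \<noteq> 0"
  then obtain b where "b * a = 1" using invertible by (metis mult.commute)
  then have "a * x = 0 \<longleftrightarrow> x = 0" for x
    by (metis mult.assoc mult_1_left mult_zero_right)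
  then show ?thesis by (auto simp: supp_def scale_def)
qed

lemma (in tract) signature_circuit:
  assumes "signature E J C" "K \<in> matroid_circuits E J"
  obtains X :: "'e \<Rightarrow> 'a" where "X \<in> C" "supp E X = K"
proof -
  have C: "C \<subseteq> E \<rightarrow>\<^sub>E UNIV"
    and bij: "bij_betw (\<lambda>K. the_elem (supp E ` K)) (C // proj_rel E C) (matroid_circuits E J)"
    using assms(1) by (auto simp: signature_def)
  obtain X where X: "X \<in> C" "K = the_elem (supp E ` (proj_rel E C `` {X}))"
    using bij_betw_imp_surj_on [OF bij] assms(2) by (auto simp: quotient_def)
  \<comment> \<open>\<open>X\<close> lies in its own class, so \<open>the_elem\<close> is applied to
    a genuine singleton.\<close>
  have "scale E 1 X = X" using X C by (auto simp: scale_def PiE_def extensional_def fun_eq_iff)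
  then have "(X, X) \<in> proj_rel E C" using X one_nonzero by (force simp: proj_rel_def)
  then have "supp E ` (proj_rel E C `` {X}) = {supp E X}"
    by (auto simp: proj_rel_def supp_scale)
  then show thesis using X that by simp
qed

lemma involution_mult:
  assumes "tract_involution N bar"
  shows "bar (x * y) = bar x * bar (y :: 'a::{comm_monoid_mult, mult_zero})"
  using assms by (cases "x = 0"; cases "y = 0") (auto simp: tract_involution_def tract_morphism_def)

lemma image_bar_gsr_mult:
  assumes "tract_involution N (bar :: 'a::{comm_monoid_mult, mult_zero} \<Rightarrow> 'a)"
  shows "image_mset bar (gsr_mult \<alpha> \<beta>) = gsr_mult (image_mset bar \<alpha>) (image_mset bar \<beta>)"
proof (induction \<alpha>)
  case (add x \<alpha>)
  have "image_mset bar (gsr_act x \<beta>) = gsr_act (bar x) (image_mset bar \<beta>)"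
    by (induction \<beta>) (auto simp: involution_mult [OF assms])
  with add show ?case by simp
qed simp

lemma image_bar_gsr_of:
  assumes "tract_involution N bar"
  shows "image_mset bar (gsr_of x) = gsr_of (bar x)"
  using assms by (auto simp: gsr_of_def tract_involution_def tract_morphism_def)

lemma dot_eq_pairing: "dot bar E X Y = pairing E X (\<lambda>e. image_mset bar (Y e))"
  by (simp add: dot_def pairing_def)

lemma dot_vec_of:
  assumes "tract_involution N bar"
  shows "dot bar E X (vec_of E Y) = pairing E X (vec (\<lambda>e. bar (Y e)))"
  unfolding dot_eq_pairing pairing_def
  by (rule sum.cong) (auto simp: vec_of_def image_bar_gsr_of [OF assms])

text \<open>As \<open>bar\<close> is its own inverse, applying it to the whole sum moves the
  conjugation from \<open>C\<close> onto \<open>Y\<close>.\<close>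

lemma pairing_bar_vec:
  assumes bar: "tract_involution N bar" and "finite E"
  shows "pairing E (\<lambda>e. image_mset bar (Y e)) (vec C) = image_mset bar (dot bar E Y (vec_of E C))"
proof -
  have "image_mset bar (\<Sum>e\<in>A. f e) = (\<Sum>e\<in>A. image_mset bar (f e))" if "finite A" for A and f :: "'b \<Rightarrow> 'a multiset"
    using that by (induction A rule: finite_induct) auto
  moreover have "bar (bar x) = x" for x using bar by (simp add: tract_involution_def)
  ultimately show ?thesis
    by (simp add: dot_vec_of [OF bar] pairing_def assms(2) image_bar_gsr_mult [OF bar] image_bar_gsr_of [OF bar])
qed

theorem theorem4p1:
  fixes N :: "'a::{comm_monoid_mult, mult_zero} multiset set"
    and bar :: "'a \<Rightarrow> 'a"
  assumes "tract N" and "tract_involution N bar"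
    and "MSF N"
  shows "strongly_perfect_tract N bar TYPE('e)"
  unfolding strongly_perfect_tract_def strongly_perfect_matroid_def orth_sets_def
proof (intro allI impI ballI)
  fix E :: "'e set" and I C D X Y
  assume M: "tract_matroid N bar E I C D"
    and X: "X \<in> gen_vectors N bar E D" and Y: "Y \<in> gen_covectors N bar E C"
  interpret msf_tract N using assms by (simp add: msf_tract_def msf_tract_axioms_def)
  interpret matroid E I using M by (simp add: tract_matroid_def)
  note bar = assms(2)
  have bar0 [simp]: "bar x = 0 \<longleftrightarrow> x = 0" for x
    using bar by (metis tract_involution_def tract_morphism_def)
  have bar_null: "image_mset bar \<alpha> \<in> N" if "\<alpha> \<in> N" for \<alpha>
    using bar that by (simp add: tract_involution_def tract_morphism_def)
  have sig: "signature E I C" "signature E (dual_indep E I) D"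
    and CD: "\<And>U V. U \<in> C \<Longrightarrow> V \<in> D \<Longrightarrow> dot bar E (vec_of E U) (vec_of E V) \<in> N"
    using M by (auto simp: tract_matroid_def dual_pair_def orth_sets_def orth_def)
  \<comment> \<open>Conjugating the cocircuits turns \<open>dot\<close> into \<open>pairing\<close>
    and preserves supports, so the dichotomy of the underlying matroid carries over.\<close>
  interpret dual_families N E C "(\<lambda>V e. bar (V e)) ` D"
  proof
    show "finite E" by (rule finite_ground)
  next
    fix U V assume U: "U \<in> C" and "V \<in> (\<lambda>V e. bar (V e)) ` D"
    then obtain V' where V': "V' \<in> D" "V = (\<lambda>e. bar (V' e))" by blast
    have "dot bar E (vec_of E U) (vec_of E V') = pairing E (vec U) (vec V)"
      unfolding dot_vec_of [OF bar] V' pairing_def by (rule sum.cong) (auto simp: vec_of_def)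
    then show "pairing E (vec U) (vec V) \<in> N" using CD U V' by metis
  next
    fix S e assume S: "S \<subseteq> E" "e \<in> S"
    have supp_bar: "supp E (\<lambda>e. bar (V e)) = supp E V" for V :: "'e \<Rightarrow> 'a" by (simp add: supp_def)
    from circuit_cocircuit_dichotomy [OF S]
    show "(\<exists>U\<in>C. supp E U \<inter> S = {e}) \<or>
      (\<exists>V\<in>(\<lambda>V e. bar (V e)) ` D. e \<in> supp E V \<and> supp E V \<subseteq> S)"
    proof
      assume "\<exists>K\<in>matroid_circuits E I. K \<inter> S = {e}"
      then obtain K where "K \<in> matroid_circuits E I" "K \<inter> S = {e}" by blast
      then show ?thesis using signature_circuit [OF sig(1)] by metis
    next
      assume "\<exists>K\<in>matroid_circuits E (dual_indep E I). e \<in> K \<and> K \<subseteq> S"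
      then obtain K where K: "K \<in> matroid_circuits E (dual_indep E I)" "e \<in> K" "K \<subseteq> S" by blast
      then obtain V where "V \<in> D" "supp E V = K" using signature_circuit [OF sig(2)] by metis
      then show ?thesis using K supp_bar by blast
    qed
  qed
  \<comment> \<open>The pairing of \<open>X\<close> with this conjugate of \<open>Y\<close> is
    \<open>dot bar E X Y\<close>.\<close>
  have "admissible X (\<lambda>e. image_mset bar (Y e))"
    unfolding admissible_def
  proof (intro conjI ballI impI)
    fix e assume "e \<in> E"
    then have "X e \<in> gsr" "Y e \<in> gsr" using X Y by (auto simp: gen_vectors_def gen_covectors_def)
    then show "0 \<notin># X e" "0 \<notin># image_mset bar (Y e)" by (auto simp: gsr_def)
  next
    fix V assume "V \<in> (\<lambda>V e. bar (V e)) ` D"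
    then show "pairing E X (vec V) \<in> N"
      using X by (auto simp: gen_vectors_def orth_def dot_vec_of [OF bar])
  next
    fix U assume "U \<in> C"
    then show "pairing E (\<lambda>e. image_mset bar (Y e)) (vec U) \<in> N"
      using Y bar_null by (simp add: gen_covectors_def orth_def pairing_bar_vec [OF bar finite_ground])
  qed
  then show "orth N bar E X Y"
    unfolding orth_def dot_eq_pairing by (rule pairing_null)
qed

end
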